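(* Let $p$ be a prime and let $V_p=k[[t]]\cap k(x,y)$ be the discrete valuation ring described in the context. Write $V_p=\varinjlim_j S_j$ as a filtered colimit of smooth $\mathbf F_p$-algebras $S_j$, and set $A_j:=\mathrm{im}(S_j\to V_p)$. Then for all $j$ sufficiently large, $A_j$ contains $x$ and $y$, so that $\mathbf F_p[x,y]\subset A_j$, and $$\dim(A_j)=\dim\mathbf F_p[x,y]+\mathrm{trdeg}_{\mathbf F_p(x,y)}\bigl(\mathrm{Frac}(A_j)\bigr)\ge 2 .$$ Hence $\dim(S_j)\ge 2$ for all $j$ sufficiently large.
   Context: Let $k=\overline{\mathbf F}_p$ and $K=k(x,y)$. Choose a non-unit power series $p(t)\in k[[t]]$ which is not algebraic over $k(t)$ (here $p(t)$ denotes a power series, not the prime $p$). The ring map $k[x,y]\to k[[t]]$, $x\mapsto t$, $y\mapsto p(t)$, is injective and induces an inclusion of fields $K\hookrightarrow k((t))$. Set $V_p:=k[[t]]\cap K$ (intersection inside $k((t))$), i.e. the valuation ring of the restriction to $K$ of the $t$-adic valuation; it is a discrete valuation ring with uniformizer $x$, residue field $k$ and fraction field $k(x,y)$. Smooth $\mathbf F_p$-algebras are of finite type; $\dim$ denotes Krull dimension. *)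

theory Defs
  imports
    "HOL-Algebra.Algebraic_Closure_Type"
    "HOL-Algebra.Generated_Fields"
    "HOL-Library.Extended_Nat"
    "Berlekamp_Zassenhaus.Finite_Field"
begin

section \<open>Commutative algebra\<close>

definition algebra_hom ::
    "('r, 'x) ring_scheme \<Rightarrow> ('r, 'a) module \<Rightarrow> ('r, 'b) module \<Rightarrow> ('a \<Rightarrow> 'b) set" where
  "algebra_hom R A B = {h \<in> Ring.ring_hom A B.
     \<forall>c\<in>carrier R. \<forall>a\<in>carrier A. h (c \<odot>\<^bsub>A\<^esub> a) = c \<odot>\<^bsub>B\<^esub> h a}"

definition finite_type_algebra :: "('r, 'x) ring_scheme \<Rightarrow> ('r, 's) module \<Rightarrow> bool" where
  "finite_type_algebra R S \<longleftrightarrow> algebra R S \<and>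
     (\<exists>G. finite G \<and> G \<subseteq> carrier S \<and>
          carrier S = generate_ring S ((\<lambda>c. c \<odot>\<^bsub>S\<^esub> \<one>\<^bsub>S\<^esub>) ` carrier R \<union> G))"

text \<open>
  Infinitesimal lifting along surjections \<open>A \<rightarrow> B\<close> of \<open>R\<close>-algebras with square-zero kernel.
  HOL cannot quantify over all carrier types inside a definition, so the test algebras are
  carried by the fixed type \<open>('s multiset \<Rightarrow> 'r) set\<close>. This loses nothing: let \<open>Q\<close> be the
  polynomial ring over \<open>R\<close> with one variable for each element of \<open>S\<close> (a set of functions
  \<open>'s multiset \<Rightarrow> 'r\<close>), and \<open>J\<close> the kernel of the evaluation \<open>Q \<rightarrow> S\<close>. Then \<open>Q/J\<^sup>2 \<rightarrow> Q/J\<close>, with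
  cosets as elements, is a test surjection of the chosen type, and a lift of
  \<open>S \<cong> Q/J\<close> along it yields lifts along every square-zero surjection, because every
  \<open>S \<rightarrow> B\<close> is covered by some \<open>Q/J\<^sup>2 \<rightarrow> A\<close>.
\<close>

definition formally_smooth_algebra :: "('r, 'x) ring_scheme \<Rightarrow> ('r, 's) module \<Rightarrow> bool" where
  "formally_smooth_algebra R S \<longleftrightarrow> algebra R S \<and>
     (\<forall>(A :: ('r, ('s multiset \<Rightarrow> 'r) set) module) (B :: ('r, ('s multiset \<Rightarrow> 'r) set) module) \<pi> u.
        algebra R A \<longrightarrow> algebra R B \<longrightarrow>
        \<pi> \<in> algebra_hom R A B \<longrightarrow> \<pi> ` carrier A = carrier B \<longrightarrow>
        (\<forall>a\<in>a_kernel A B \<pi>. \<forall>b\<in>a_kernel A B \<pi>. a \<otimes>\<^bsub>A\<^esub> b = \<zero>\<^bsub>A\<^esub>) \<longrightarrow>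
        u \<in> algebra_hom R S B \<longrightarrow>
        (\<exists>v\<in>algebra_hom R S A. \<forall>s\<in>carrier S. \<pi> (v s) = u s))"

text \<open>
  Smooth means formally smooth and of finite presentation. The definition is restricted to
  Noetherian \<open>R\<close>, where finite presentation is the same as finite type.
\<close>

definition smooth_algebra :: "('r, 'x) ring_scheme \<Rightarrow> ('r, 's) module \<Rightarrow> bool" where
  "smooth_algebra R S \<longleftrightarrow>
     cring R \<and> noetherian_ring R \<and> finite_type_algebra R S \<and> formally_smooth_algebra R S"

text \<open>
  The Krull dimension is the supremum of the lengths of strict chains of prime ideals. With
  values in \<^typ>\<open>enat\<close> the zero ring gets dimension \<open>0\<close> (the supremum of the empty set).
\<close>

definition krull_dim :: "('a, 'x) ring_scheme \<Rightarrow> enat" where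
  "krull_dim R = Sup {enat n | n. \<exists>P :: nat \<Rightarrow> 'a set.
     (\<forall>i\<le>n. primeideal (P i) R) \<and> (\<forall>i<n. P i \<subset> P (Suc i))}"

text \<open>
  A finite set \<open>B\<close> is algebraically independent over \<open>F\<close> if no polynomial over \<open>F\<close> in
  variables indexed by \<open>B\<close>, with exponent set \<open>M\<close> and coefficients \<open>c\<close>, vanishes at \<open>B\<close>
  unless it is zero.
\<close>

definition alg_independent :: "('a, 'x) ring_scheme \<Rightarrow> 'a set \<Rightarrow> 'a set \<Rightarrow> bool" where
  "alg_independent R F B \<longleftrightarrow> finite B \<and> B \<subseteq> carrier R \<and>
     (\<forall>(M :: ('a \<Rightarrow> nat) set) c.
        finite M \<longrightarrow> (\<forall>m\<in>M. \<forall>b. b \<notin> B \<longrightarrow> m b = 0) \<longrightarrow> c \<in> M \<rightarrow> F \<longrightarrow>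
        (\<Oplus>\<^bsub>R\<^esub>m\<in>M. c m \<otimes>\<^bsub>R\<^esub> (\<Otimes>\<^bsub>R\<^esub>b\<in>B. b [^]\<^bsub>R\<^esub> m b)) = \<zero>\<^bsub>R\<^esub> \<longrightarrow>
        (\<forall>m\<in>M. c m = \<zero>\<^bsub>R\<^esub>))"

text \<open>Transcendence degree of \<open>L\<close> over \<open>F\<close>, both subfields of \<open>R\<close>.\<close>

definition trdeg :: "('a, 'x) ring_scheme \<Rightarrow> 'a set \<Rightarrow> 'a set \<Rightarrow> enat" where
  "trdeg R F L = Sup {enat (card B) | B. B \<subseteq> L \<and> alg_independent R F B}"


section \<open>Filtered colimits of algebras\<close>

record ('o, 'm) cat =
  Ob :: "'o set"
  Hom :: "'o \<Rightarrow> 'o \<Rightarrow> 'm set"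
  Ident :: "'o \<Rightarrow> 'm"
  Comp :: "'m \<Rightarrow> 'm \<Rightarrow> 'm"

locale small_category =
  fixes J :: "('o, 'm) cat"
  assumes Ident_in: "i \<in> Ob J \<Longrightarrow> Ident J i \<in> Hom J i i"
    and Comp_in: "\<lbrakk>i \<in> Ob J; j \<in> Ob J; l \<in> Ob J; f \<in> Hom J i j; g \<in> Hom J j l\<rbrakk>
      \<Longrightarrow> Comp J g f \<in> Hom J i l"
    and Comp_Ident: "\<lbrakk>i \<in> Ob J; j \<in> Ob J; f \<in> Hom J i j\<rbrakk> \<Longrightarrow> Comp J f (Ident J i) = f"
    and Ident_Comp: "\<lbrakk>i \<in> Ob J; j \<in> Ob J; f \<in> Hom J i j\<rbrakk> \<Longrightarrow> Comp J (Ident J j) f = f"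
    and Comp_assoc: "\<lbrakk>i \<in> Ob J; j \<in> Ob J; l \<in> Ob J; q \<in> Ob J;
        f \<in> Hom J i j; g \<in> Hom J j l; h \<in> Hom J l q\<rbrakk>
      \<Longrightarrow> Comp J h (Comp J g f) = Comp J (Comp J h g) f"

locale filtered_category = small_category +
  assumes nonempty: "Ob J \<noteq> {}"
    and bound: "\<lbrakk>i \<in> Ob J; j \<in> Ob J\<rbrakk> \<Longrightarrow> \<exists>l\<in>Ob J. Hom J i l \<noteq> {} \<and> Hom J j l \<noteq> {}"
    and coequalize: "\<lbrakk>i \<in> Ob J; j \<in> Ob J; f \<in> Hom J i j; g \<in> Hom J i j\<rbrakk>
      \<Longrightarrow> \<exists>l\<in>Ob J. \<exists>h\<in>Hom J j l. Comp J h f = Comp J h g"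

locale algebra_diagram = small_category J
  for J :: "('o, 'm) cat" and R :: "('r, 'x) ring_scheme"
    and S :: "'o \<Rightarrow> ('r, 's) module" and T :: "'o \<Rightarrow> 'o \<Rightarrow> 'm \<Rightarrow> 's \<Rightarrow> 's" +
  assumes algebra: "i \<in> Ob J \<Longrightarrow> algebra R (S i)"
    and T_hom: "\<lbrakk>i \<in> Ob J; j \<in> Ob J; f \<in> Hom J i j\<rbrakk> \<Longrightarrow> T i j f \<in> algebra_hom R (S i) (S j)"
    and T_Ident: "\<lbrakk>i \<in> Ob J; a \<in> carrier (S i)\<rbrakk> \<Longrightarrow> T i i (Ident J i) a = a"
    and T_Comp: "\<lbrakk>i \<in> Ob J; j \<in> Ob J; l \<in> Ob J; f \<in> Hom J i j; g \<in> Hom J j l; a \<in> carrier (S i)\<rbrakk>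
      \<Longrightarrow> T i l (Comp J g f) a = T j l g (T i j f a)"

definition algebra_cocone ::
    "('o, 'm) cat \<Rightarrow> ('r, 'x) ring_scheme \<Rightarrow> ('o \<Rightarrow> ('r, 's) module) \<Rightarrow>
     ('o \<Rightarrow> 'o \<Rightarrow> 'm \<Rightarrow> 's \<Rightarrow> 's) \<Rightarrow> ('r, 'v) module \<Rightarrow> ('o \<Rightarrow> 's \<Rightarrow> 'v) \<Rightarrow> bool" where
  "algebra_cocone J R S T V \<phi> \<longleftrightarrow> algebra R V \<and>
     (\<forall>i\<in>Ob J. \<phi> i \<in> algebra_hom R (S i) V) \<and>
     (\<forall>i\<in>Ob J. \<forall>j\<in>Ob J. \<forall>f\<in>Hom J i j. \<forall>a\<in>carrier (S i). \<phi> j (T i j f a) = \<phi> i a)"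

text \<open>
  The filtered colimit is the disjoint union of the \<open>S i\<close> modulo the relation below.
\<close>

definition colimit_rel ::
    "('o, 'm) cat \<Rightarrow> ('o \<Rightarrow> ('r, 's) module) \<Rightarrow> ('o \<Rightarrow> 'o \<Rightarrow> 'm \<Rightarrow> 's \<Rightarrow> 's) \<Rightarrow> ('o \<times> 's) rel" where
  "colimit_rel J S T =
     {((i, a), (j, b)). i \<in> Ob J \<and> a \<in> carrier (S i) \<and> j \<in> Ob J \<and> b \<in> carrier (S j) \<and>
        (\<exists>l\<in>Ob J. \<exists>f\<in>Hom J i l. \<exists>g\<in>Hom J j l. T i l f a = T j l g b)}"

text \<open>
  \<open>V\<close> with the maps \<open>\<phi> i\<close> is the filtered colimit of the diagram if the induced map from the
  above construction to \<open>V\<close> is bijective; see \<open>filtered_colimit_universal\<close> below.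
\<close>

definition is_filtered_colimit ::
    "('o, 'm) cat \<Rightarrow> ('r, 'x) ring_scheme \<Rightarrow> ('o \<Rightarrow> ('r, 's) module) \<Rightarrow>
     ('o \<Rightarrow> 'o \<Rightarrow> 'm \<Rightarrow> 's \<Rightarrow> 's) \<Rightarrow> ('r, 'v) module \<Rightarrow> ('o \<Rightarrow> 's \<Rightarrow> 'v) \<Rightarrow> bool" where
  "is_filtered_colimit J R S T V \<phi> \<longleftrightarrow>
     filtered_category J \<and> algebra_diagram J R S T \<and> algebra_cocone J R S T V \<phi> \<and>
     bij_betw (\<lambda>c. the_elem ((\<lambda>(i, a). \<phi> i a) ` c))
       ((SIGMA i : Ob J. carrier (S i)) // colimit_rel J S T) (carrier V)"

lemma filtered_colimit_facts:
  assumes V: "is_filtered_colimit J R S T V \<phi>"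
  shows filtered_colimit_surj:
      "v \<in> carrier V \<Longrightarrow> \<exists>i\<in>Ob J. \<exists>a\<in>carrier (S i). v = \<phi> i a"
    and filtered_colimit_eq:
      "\<lbrakk>i \<in> Ob J; a \<in> carrier (S i); j \<in> Ob J; b \<in> carrier (S j); \<phi> i a = \<phi> j b\<rbrakk>
        \<Longrightarrow> \<exists>l\<in>Ob J. \<exists>f\<in>Hom J i l. \<exists>g\<in>Hom J j l. T i l f a = T j l g b"
proof -
  let ?r = "colimit_rel J S T"
  let ?X = "SIGMA i : Ob J. carrier (S i)"
  let ?e = "\<lambda>c. the_elem ((\<lambda>(i, a). \<phi> i a) ` c)"
  have bij: "bij_betw ?e (?X // ?r) (carrier V)"
    and cocone: "algebra_cocone J R S T V \<phi>" and diag: "algebra_diagram J R S T"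
    using V by (auto simp: is_filtered_colimit_def)
  interpret algebra_diagram J R S T by (rule diag)
  have refl: "((i, a), (i, a)) \<in> ?r" if "i \<in> Ob J" "a \<in> carrier (S i)" for i a
    using that Ident_in[of i] by (auto simp: colimit_rel_def)
  have same: "\<phi> i a = \<phi> j b" if "((i, a), (j, b)) \<in> ?r" for i a j b
  proof -
    from that have ij: "i \<in> Ob J" "a \<in> carrier (S i)" "j \<in> Ob J" "b \<in> carrier (S j)"
      and ex: "\<exists>l\<in>Ob J. \<exists>f\<in>Hom J i l. \<exists>g\<in>Hom J j l. T i l f a = T j l g b"
      by (simp_all add: colimit_rel_def)
    from ex obtain l f g where l: "l \<in> Ob J" "f \<in> Hom J i l" "g \<in> Hom J j l"
      and eq: "T i l f a = T j l g b" by blast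
    have "\<phi> l (T i l f a) = \<phi> i a" "\<phi> l (T j l g b) = \<phi> j b"
      using cocone ij l by (auto simp: algebra_cocone_def)
    with eq show ?thesis by simp
  qed
  have val: "?e (?r `` {(i, a)}) = \<phi> i a" if "i \<in> Ob J" "a \<in> carrier (S i)" for i a
  proof -
    have "(\<lambda>(i, a). \<phi> i a) ` (?r `` {(i, a)}) = {\<phi> i a}"
    proof (intro equalityI subsetI)
      fix w assume "w \<in> (\<lambda>(i, a). \<phi> i a) ` (?r `` {(i, a)})"
      then obtain p where p: "((i, a), p) \<in> ?r" "w = (\<lambda>(i, a). \<phi> i a) p" by blast
      thus "w \<in> {\<phi> i a}" using same[of i a "fst p" "snd p"] by (simp add: case_prod_beta)
    next
      fix w assume "w \<in> {\<phi> i a}"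
      thus "w \<in> (\<lambda>(i, a). \<phi> i a) ` (?r `` {(i, a)})" using refl[OF that] by (auto intro: image_eqI)
    qed
    thus ?thesis by simp
  qed
  show "\<exists>i\<in>Ob J. \<exists>a\<in>carrier (S i). v = \<phi> i a" if "v \<in> carrier V"
  proof -
    have "v \<in> ?e ` (?X // ?r)" using bij that by (simp add: bij_betw_def)
    then obtain i a where "i \<in> Ob J" "a \<in> carrier (S i)" "v = ?e (?r `` {(i, a)})"
      by (auto simp: quotient_def)
    thus ?thesis using val[of i a] by auto
  qed
  show "\<exists>l\<in>Ob J. \<exists>f\<in>Hom J i l. \<exists>g\<in>Hom J j l. T i l f a = T j l g b"
    if "i \<in> Ob J" "a \<in> carrier (S i)" "j \<in> Ob J" "b \<in> carrier (S j)" "\<phi> i a = \<phi> j b"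
  proof -
    have "?r `` {(i, a)} = ?r `` {(j, b)}"
    proof (rule inj_onD[OF bij_betw_imp_inj_on[OF bij]])
      show "?e (?r `` {(i, a)}) = ?e (?r `` {(j, b)})"
        unfolding val[OF that(1,2)] val[OF that(3,4)] by (rule that(5))
      show "?r `` {(i, a)} \<in> ?X // ?r" "?r `` {(j, b)} \<in> ?X // ?r"
        using that(1-4) by (simp_all add: quotientI)
    qed
    moreover have "(j, b) \<in> ?r `` {(j, b)}" using refl[OF that(3,4)] by simp
    ultimately have "(j, b) \<in> ?r `` {(i, a)}" by (simp only:)
    hence "((i, a), (j, b)) \<in> ?r" by simp
    thus ?thesis by (auto simp: colimit_rel_def)
  qed
qed

lemma filtered_colimit_universal:
  assumes V: "is_filtered_colimit J R S T V \<phi>" and W: "algebra_cocone J R S T W \<psi>"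
  shows "\<exists>h\<in>algebra_hom R V W. \<forall>i\<in>Ob J. \<forall>a\<in>carrier (S i). h (\<phi> i a) = \<psi> i a"
    and "\<lbrakk>\<forall>i\<in>Ob J. \<forall>a\<in>carrier (S i). h (\<phi> i a) = \<psi> i a;
      \<forall>i\<in>Ob J. \<forall>a\<in>carrier (S i). h' (\<phi> i a) = \<psi> i a; v \<in> carrier V\<rbrakk> \<Longrightarrow> h v = h' v"
proof -
  have cocone: "algebra_cocone J R S T V \<phi>" and diag: "algebra_diagram J R S T"
    and filt: "filtered_category J"
    using V by (auto simp: is_filtered_colimit_def)
  interpret algebra_diagram J R S T by (rule diag)
  interpret filtered_category J by (rule filt)
  have \<phi>: "\<phi> i \<in> algebra_hom R (S i) V" and \<psi>: "\<psi> i \<in> algebra_hom R (S i) W"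
    if "i \<in> Ob J" for i using cocone W that by (auto simp: algebra_cocone_def)
  have \<phi>T: "\<phi> j (T i j f a) = \<phi> i a" and \<psi>T: "\<psi> j (T i j f a) = \<psi> i a"
    if "i \<in> Ob J" "j \<in> Ob J" "f \<in> Hom J i j" "a \<in> carrier (S i)" for i j f a
    using cocone W that by (auto simp: algebra_cocone_def)
  have wd: "\<psi> i a = \<psi> j b"
    if ij: "i \<in> Ob J" "a \<in> carrier (S i)" "j \<in> Ob J" "b \<in> carrier (S j)" "\<phi> i a = \<phi> j b" for i a j b
    using filtered_colimit_eq[OF V ij] \<psi>T ij by metis
  define h where "h v = (SOME w. \<exists>i\<in>Ob J. \<exists>a\<in>carrier (S i). v = \<phi> i a \<and> w = \<psi> i a)" for v
  have h: "h (\<phi> i a) = \<psi> i a" if "i \<in> Ob J" "a \<in> carrier (S i)" for i a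
    unfolding h_def
  proof (rule some_equality)
    show "\<exists>j\<in>Ob J. \<exists>b\<in>carrier (S j). \<phi> i a = \<phi> j b \<and> \<psi> i a = \<psi> j b" using that by blast
    show "w = \<psi> i a" if "\<exists>j\<in>Ob J. \<exists>b\<in>carrier (S j). \<phi> i a = \<phi> j b \<and> w = \<psi> j b" for w
      using that wd[OF \<open>i \<in> Ob J\<close> \<open>a \<in> carrier (S i)\<close>] by auto
  qed
  have two: "\<exists>l\<in>Ob J. \<exists>a\<in>carrier (S l). \<exists>b\<in>carrier (S l). v = \<phi> l a \<and> w = \<phi> l b"
    if vw: "v \<in> carrier V" "w \<in> carrier V" for v w
  proof -
    obtain i a where i: "i \<in> Ob J" "a \<in> carrier (S i)" "v = \<phi> i a"
      using filtered_colimit_surj[OF V vw(1)] by blast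
    obtain j b where j: "j \<in> Ob J" "b \<in> carrier (S j)" "w = \<phi> j b"
      using filtered_colimit_surj[OF V vw(2)] by blast
    obtain l f g where l: "l \<in> Ob J" "f \<in> Hom J i l" "g \<in> Hom J j l"
      using bound[OF i(1) j(1)] by blast
    have "T i l f a \<in> carrier (S l)" "T j l g b \<in> carrier (S l)"
      using T_hom[OF i(1) l(1,2)] T_hom[OF j(1) l(1,3)] i j
      by (auto simp: algebra_hom_def Ring.ring_hom_def)
    moreover have "v = \<phi> l (T i l f a)" "w = \<phi> l (T j l g b)" using \<phi>T i j l by auto
    ultimately show ?thesis using l(1) by blast
  qed
  have "h \<in> algebra_hom R V W"
    unfolding algebra_hom_def
  proof (intro CollectI conjI ballI Ring.ring_hom_memI)
    fix v w assume vw: "v \<in> carrier V" "w \<in> carrier V"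
    then obtain l a b where l: "l \<in> Ob J" "a \<in> carrier (S l)" "b \<in> carrier (S l)"
      "v = \<phi> l a" "w = \<phi> l b" using two by blast
    interpret A: Module.algebra R "S l" using algebra l by simp
    have "a \<otimes>\<^bsub>S l\<^esub> b \<in> carrier (S l)" "a \<oplus>\<^bsub>S l\<^esub> b \<in> carrier (S l)" using l by auto
    hence "h (\<phi> l (a \<otimes>\<^bsub>S l\<^esub> b)) = \<psi> l (a \<otimes>\<^bsub>S l\<^esub> b)" "h (\<phi> l (a \<oplus>\<^bsub>S l\<^esub> b)) = \<psi> l (a \<oplus>\<^bsub>S l\<^esub> b)"
      using h l by auto
    moreover have "\<phi> l (a \<otimes>\<^bsub>S l\<^esub> b) = v \<otimes>\<^bsub>V\<^esub> w" "\<phi> l (a \<oplus>\<^bsub>S l\<^esub> b) = v \<oplus>\<^bsub>V\<^esub> w"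
      using \<phi>[OF l(1)] l by (auto simp: algebra_hom_def Ring.ring_hom_def)
    moreover have "\<psi> l (a \<otimes>\<^bsub>S l\<^esub> b) = h v \<otimes>\<^bsub>W\<^esub> h w" "\<psi> l (a \<oplus>\<^bsub>S l\<^esub> b) = h v \<oplus>\<^bsub>W\<^esub> h w"
      using \<psi>[OF l(1)] h l by (auto simp: algebra_hom_def Ring.ring_hom_def)
    ultimately show "h (v \<otimes>\<^bsub>V\<^esub> w) = h v \<otimes>\<^bsub>W\<^esub> h w" "h (v \<oplus>\<^bsub>V\<^esub> w) = h v \<oplus>\<^bsub>W\<^esub> h w"
      by simp_all
  next
    fix v assume "v \<in> carrier V"
    then obtain l a where l: "l \<in> Ob J" "a \<in> carrier (S l)" "v = \<phi> l a"
      using filtered_colimit_surj[OF V] by blast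
    thus "h v \<in> carrier W" using \<psi>[OF l(1)] h by (auto simp: algebra_hom_def Ring.ring_hom_def)
    fix c assume c: "c \<in> carrier R"
    interpret A: Module.algebra R "S l" using algebra l by simp
    have "h (\<phi> l (c \<odot>\<^bsub>S l\<^esub> a)) = \<psi> l (c \<odot>\<^bsub>S l\<^esub> a)" using c l h by auto
    moreover have "\<phi> l (c \<odot>\<^bsub>S l\<^esub> a) = c \<odot>\<^bsub>V\<^esub> v" "\<psi> l (c \<odot>\<^bsub>S l\<^esub> a) = c \<odot>\<^bsub>W\<^esub> h v"
      using \<phi>[OF l(1)] \<psi>[OF l(1)] h l c by (auto simp: algebra_hom_def)
    ultimately show "h (c \<odot>\<^bsub>V\<^esub> v) = c \<odot>\<^bsub>W\<^esub> h v" by simp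
  next
    obtain l where l: "l \<in> Ob J" using nonempty by blast
    interpret A: Module.algebra R "S l" using algebra l by simp
    have "h (\<phi> l \<one>\<^bsub>S l\<^esub>) = \<psi> l \<one>\<^bsub>S l\<^esub>" using h l by auto
    thus "h \<one>\<^bsub>V\<^esub> = \<one>\<^bsub>W\<^esub>"
      using \<phi>[OF l] \<psi>[OF l] by (auto simp: algebra_hom_def Ring.ring_hom_def)
  qed
  with h show "\<exists>h\<in>algebra_hom R V W. \<forall>i\<in>Ob J. \<forall>a\<in>carrier (S i). h (\<phi> i a) = \<psi> i a"
    by blast
  show "h v = h' v" if "\<forall>i\<in>Ob J. \<forall>a\<in>carrier (S i). h (\<phi> i a) = \<psi> i a"
      "\<forall>i\<in>Ob J. \<forall>a\<in>carrier (S i). h' (\<phi> i a) = \<psi> i a" "v \<in> carrier V" for h h'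
    using filtered_colimit_surj[OF V that(3)] that(1,2) by fastforce
qed


section \<open>The valuation ring\<close>

abbreviation prime_field :: "'p::prime_card mod_ring ring" where
  "prime_field \<equiv> ring_of_type_algebra"

text \<open>
  \<open>k((t))\<close>, \<open>k\<close> an algebraic closure of the field \<open>'p mod_ring\<close> with \<open>p = CARD('p)\<close> elements,
  as an algebra over the latter.
\<close>

definition laurent ::
    "('p::prime_card mod_ring, 'p mod_ring alg_closure fls) module" where
  "laurent = \<lparr>carrier = UNIV, monoid.mult = (*), one = 1, ring.zero = 0, add = (+),
     module.smult = (\<lambda>c f. fls_const (to_ac c) * f)\<rparr>"

abbreviation sub_laurent ::
    "'p mod_ring alg_closure fls set \<Rightarrow> ('p::prime_card mod_ring, 'p mod_ring alg_closure fls) module"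
    where "sub_laurent A \<equiv> laurent\<lparr>carrier := A\<rparr>"

text \<open>
  \<open>K = k(x,y)\<close> is identified with its image under the embedding \<open>x \<mapsto> t\<close>, \<open>y \<mapsto> p(t)\<close> into
  \<open>k((t))\<close>, so that \<open>x\<close> is \<^term>\<open>fls_X\<close> and \<open>y\<close> is \<^term>\<open>fps_to_fls y\<close> for the power series
  \<open>y = p(t)\<close>. All other rings below are likewise subrings of \<open>k((t))\<close>, and fraction fields are
  generated inside \<open>k((t))\<close>.
\<close>

definition field_kt :: "'p::prime_card mod_ring alg_closure fls set" where
  "field_kt = generate_field laurent (range fls_const \<union> {fls_X})"

definition field_kxy ::
    "'p::prime_card mod_ring alg_closure fps \<Rightarrow> 'p mod_ring alg_closure fls set" where
  "field_kxy y = generate_field laurent (range fls_const \<union> {fls_X, fps_to_fls y})"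

definition valuation_ring ::
    "'p::prime_card mod_ring alg_closure fps \<Rightarrow> 'p mod_ring alg_closure fls set" where
  "valuation_ring y = range fps_to_fls \<inter> field_kxy y"

definition ring_Fpxy ::
    "'p::prime_card mod_ring alg_closure fps \<Rightarrow> 'p mod_ring alg_closure fls set" where
  "ring_Fpxy y = generate_ring laurent (range (fls_const \<circ> to_ac) \<union> {fls_X, fps_to_fls y})"

abbreviation fraction_field ::
    "'p::prime_card mod_ring alg_closure fls set \<Rightarrow> 'p mod_ring alg_closure fls set" where
  "fraction_field A \<equiv> generate_field laurent A"

lemma field_laurent: "Ring.field (laurent :: ('p::prime_card mod_ring, _) module)"
proof -
  have x: "\<exists>y. x + y = 0" for x :: "'p mod_ring alg_closure fls"
    using add.right_inverse by blast
  have y: "\<exists>y. x * y = 1" if "x \<noteq> 0" for x :: "'p mod_ring alg_closure fls"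
    using that by (intro exI[of _ "inverse x"]) auto
  show ?thesis
    by unfold_locales (auto simp: laurent_def algebra_simps Units_def x y)
qed

lemma algebra_valuation_ring:
  fixes y :: "'p::prime_card mod_ring alg_closure fps"
  shows "algebra prime_field (sub_laurent (valuation_ring y))"
proof -
  interpret F: Ring.field "laurent :: ('p mod_ring, _) module" by (rule field_laurent)
  have K: "subring (field_kxy y) laurent"
    unfolding field_kxy_def
    by (intro subfieldE(1) F.generate_field_is_subfield) (auto simp: laurent_def)
  have minus: "\<ominus>\<^bsub>laurent\<^esub> x = - x" for x :: "'p mod_ring alg_closure fls"
  proof (rule F.minus_equality)
    show "- x \<oplus>\<^bsub>laurent\<^esub> x = \<zero>\<^bsub>laurent\<^esub>" by (simp add: laurent_def)
  qed (auto simp: laurent_def)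
  have "subring (range (fps_to_fls :: 'p mod_ring alg_closure fps \<Rightarrow> _)) laurent"
  proof (rule F.subringI)
    show "\<one>\<^bsub>laurent\<^esub> \<in> range (fps_to_fls :: 'p mod_ring alg_closure fps \<Rightarrow> _)"
      by (auto simp: laurent_def intro: range_eqI[of _ _ 1])
  qed (auto simp: minus, auto simp: laurent_def simp flip: fps_to_fls_plus fps_to_fls_uminus fls_times_fps_to_fls)
  hence V: "subcring (valuation_ring y) laurent"
    unfolding valuation_ring_def using K by (intro F.subcringI' F.subring_inter)
  have const: "fls_const (to_ac c) \<in> valuation_ring y" for c
  proof -
    have "fls_const (to_ac c) = fps_to_fls (fps_const (to_ac c))" by simp
    moreover have "fls_const (to_ac c) \<in> field_kxy y"
      unfolding field_kxy_def by (rule generate_field.incl) blast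
    ultimately show ?thesis unfolding valuation_ring_def by blast
  qed
  show ?thesis
  proof (rule algebraI)
    show "cring (sub_laurent (valuation_ring y))"
      using F.subcring_iff[of "valuation_ring y"] V by (simp add: laurent_def)
    show "c \<odot>\<^bsub>sub_laurent (valuation_ring y)\<^esub> f \<in> carrier (sub_laurent (valuation_ring y))"
      if "f \<in> carrier (sub_laurent (valuation_ring y))" for c f
      using subcringE(6)[OF V const[of c], of f] that by (simp add: laurent_def)
  qed (auto simp: laurent_def ring_of_type_algebra_def ring_distribs mult_ac simp flip: fls_plus_const fls_const_mult_const
       intro: cring_from_type_algebra[where ?'a = "'p mod_ring", unfolded ring_of_type_algebra_def])
qed

end

(*
  Dimension and transcendence degree of a finitely generated domain A over a field F are compared
  without Noether normalization. Choosing f_i in P_i - P_(i-1) along a chain of primes gives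
  algebraically independent elements. Conversely, a transcendence basis b_1, ..., b_d yields a chain
  by induction: localise at F[b_d] - {0}, contract the chain of length d - 1 found there, and note
  that its top prime P is not maximal, since otherwise A/P would be a field that is finitely
  generated over F and contains the transcendental element b_d (Zariski's lemma). The formula then
  is additivity of the transcendence degree, where x and y are independent over F_p because y is
  transcendental over k(x). Once the colimit has reached an A_j containing x and y, all later A_j do.
*)

theory Submission
  imports Defs
begin

section \<open>Subrings, towers and prime chains\<close>

text \<open>All rings are subsets of one ambient field, and quotients occur only as congruences
  \<open>a - b \<in> P\<close>. Localising at \<open>B[b] - {0}\<close> therefore just replaces the
  base \<open>B\<close> by \<open>frac (ring_gen (insert b B))\<close> and keeps the generators
  \<open>gs\<close>; this is why the statements allow an arbitrary subring as base. Zariski's lemma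
  has to work over \<open>B[b]\<close>, which is not a field. It is replaced by the property of
  becoming a field after inverting one element: this descends from \<open>B[g]\<close> to
  \<open>B\<close>, one generator at a time, and fails for a polynomial ring. Independence is kept
  as a list of successive transcendental elements: a prime chain adds entries at the head, a
  localisation removes the last one. No finiteness of dimension or transcendence degree is needed: a
  number is the length of a prime chain exactly when it is the length of an independent list, so
  both suprema are taken over the same set of numbers.\<close>

definition csubring :: "'a::comm_ring_1 set \<Rightarrow> bool" where
  "csubring B \<longleftrightarrow> 1 \<in> B \<and> (\<forall>a\<in>B. \<forall>b\<in>B. a - b \<in> B \<and> a * b \<in> B)"

lemma csubring_1: "csubring B \<Longrightarrow> 1 \<in> B"
  and csubring_diff: "csubring B \<Longrightarrow> a \<in> B \<Longrightarrow> b \<in> B \<Longrightarrow> a - b \<in> B"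
  and csubring_mult: "csubring B \<Longrightarrow> a \<in> B \<Longrightarrow> b \<in> B \<Longrightarrow> a * b \<in> B"
  by (auto simp: csubring_def)

lemma csubring_0: "csubring B \<Longrightarrow> 0 \<in> B"
  using csubring_diff[of B 1 1] csubring_1[of B] by simp

lemma csubring_uminus: "csubring B \<Longrightarrow> a \<in> B \<Longrightarrow> - a \<in> B"
  using csubring_diff[of B 0 a] csubring_0[of B] by simp

lemma csubring_add: "csubring B \<Longrightarrow> a \<in> B \<Longrightarrow> b \<in> B \<Longrightarrow> a + b \<in> B"
  using csubring_diff[of B a "- b"] csubring_uminus[of B b] by simp

lemma csubring_power: "csubring B \<Longrightarrow> a \<in> B \<Longrightarrow> a ^ n \<in> B"
  by (induction n) (auto intro: csubring_1 csubring_mult)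

lemma csubring_sum: "csubring B \<Longrightarrow> (\<And>i. i \<in> I \<Longrightarrow> f i \<in> B) \<Longrightarrow> sum f I \<in> B"
  by (induction I rule: infinite_finite_induct) (auto intro: csubring_0 csubring_add)

lemma csubring_prod: "csubring B \<Longrightarrow> (\<And>i. i \<in> I \<Longrightarrow> f i \<in> B) \<Longrightarrow> prod f I \<in> B"
  by (induction I rule: infinite_finite_induct) (auto intro: csubring_1 csubring_mult)

lemmas csubring_closed = csubring_0 csubring_1 csubring_add csubring_diff csubring_uminus
  csubring_mult csubring_power csubring_sum csubring_prod

definition ring_gen :: "'a::comm_ring_1 set \<Rightarrow> 'a set" where
  "ring_gen G = {x. \<forall>B. csubring B \<longrightarrow> G \<subseteq> B \<longrightarrow> x \<in> B}"

lemma csubring_ring_gen: "csubring (ring_gen G)"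
  by (auto simp: ring_gen_def csubring_def)

lemma ring_gen_incl: "G \<subseteq> ring_gen G"
  by (auto simp: ring_gen_def)

lemma ring_gen_minimal: "csubring B \<Longrightarrow> G \<subseteq> B \<Longrightarrow> ring_gen G \<subseteq> B"
  by (auto simp: ring_gen_def)

lemma ring_gen_mono: "G \<subseteq> H \<Longrightarrow> ring_gen G \<subseteq> ring_gen H"
  by (auto simp: ring_gen_def)

lemma ring_gen_id: "csubring B \<Longrightarrow> ring_gen B = B"
  using ring_gen_incl[of B] ring_gen_minimal[of B B] by auto

lemma ring_gen_Un: "ring_gen (ring_gen G \<union> H) = ring_gen (G \<union> H)"
proof
  show "ring_gen (ring_gen G \<union> H) \<subseteq> ring_gen (G \<union> H)"
    using ring_gen_incl[of "G \<union> H"] ring_gen_mono[of G "G \<union> H"]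
    by (intro ring_gen_minimal csubring_ring_gen) auto
  show "ring_gen (G \<union> H) \<subseteq> ring_gen (ring_gen G \<union> H)"
    using ring_gen_incl[of G] by (intro ring_gen_mono) auto
qed

lemma ring_gen_insert_ring_gen: "ring_gen (insert g (ring_gen G)) = ring_gen (insert g G)"
  using ring_gen_Un[of G "{g}"] by simp

section \<open>Polynomials over a subring, inside the polynomials over the ambient ring\<close>

definition coeffs_in :: "'a::zero set \<Rightarrow> 'a poly set" where
  "coeffs_in B = {p. \<forall>i. coeff p i \<in> B}"

lemma coeff_coeffs_in: "p \<in> coeffs_in B \<Longrightarrow> coeff p i \<in> B"
  by (simp add: coeffs_in_def)

context
  fixes B :: "'a::comm_ring_1 set"
  assumes B: "csubring B"
begin

lemma coeffs_in_0: "0 \<in> coeffs_in B"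
  using B by (auto simp: coeffs_in_def intro: csubring_closed)

lemma coeffs_in_add: "p \<in> coeffs_in B \<Longrightarrow> q \<in> coeffs_in B \<Longrightarrow> p + q \<in> coeffs_in B"
  using B by (auto simp: coeffs_in_def intro: csubring_closed)

lemma coeffs_in_diff: "p \<in> coeffs_in B \<Longrightarrow> q \<in> coeffs_in B \<Longrightarrow> p - q \<in> coeffs_in B"
  using B by (auto simp: coeffs_in_def intro: csubring_closed)

lemma coeffs_in_mult: "p \<in> coeffs_in B \<Longrightarrow> q \<in> coeffs_in B \<Longrightarrow> p * q \<in> coeffs_in B"
  using B by (auto simp: coeffs_in_def coeff_mult intro!: csubring_closed)

lemma coeffs_in_smult: "c \<in> B \<Longrightarrow> q \<in> coeffs_in B \<Longrightarrow> smult c q \<in> coeffs_in B"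
  using B by (auto simp: coeffs_in_def intro!: csubring_closed)

lemma coeffs_in_monom: "c \<in> B \<Longrightarrow> monom c n \<in> coeffs_in B"
  using B by (auto simp: coeffs_in_def intro: csubring_closed)

lemma coeffs_in_pCons: "c \<in> B \<Longrightarrow> q \<in> coeffs_in B \<Longrightarrow> pCons c q \<in> coeffs_in B"
  using B by (auto simp: coeffs_in_def coeff_pCons split: nat.split)

lemma coeffs_in_1: "1 \<in> coeffs_in B"
  unfolding one_pCons by (intro coeffs_in_pCons coeffs_in_0 csubring_1 B)

lemma coeffs_in_sum: "(\<And>i. i \<in> I \<Longrightarrow> f i \<in> coeffs_in B) \<Longrightarrow> sum f I \<in> coeffs_in B"
  by (induction I rule: infinite_finite_induct) (auto intro: coeffs_in_0 coeffs_in_add)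

lemma poly_coeffs_in:
  assumes "csubring C" "B \<subseteq> C" "p \<in> coeffs_in B" "x \<in> C"
  shows "poly p x \<in> C"
  using assms coeff_coeffs_in[OF assms(3)] unfolding poly_altdef
  by (intro csubring_closed) auto

lemmas coeffs_in_closed = coeffs_in_0 coeffs_in_1 coeffs_in_add coeffs_in_diff coeffs_in_mult
  coeffs_in_smult coeffs_in_monom coeffs_in_pCons

lemma ring_gen_insert: "ring_gen (insert x B) = (\<lambda>p. poly p x) ` coeffs_in B"
proof
  have "csubring ((\<lambda>p. poly p x) ` coeffs_in B)"
    unfolding csubring_def
  proof (intro conjI ballI)
    show "1 \<in> (\<lambda>p. poly p x) ` coeffs_in B"
      using coeffs_in_1 by (auto intro!: image_eqI[of _ _ 1])
    fix a b assume "a \<in> (\<lambda>p. poly p x) ` coeffs_in B" "b \<in> (\<lambda>p. poly p x) ` coeffs_in B"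
    then obtain p q where "p \<in> coeffs_in B" "q \<in> coeffs_in B" "a = poly p x" "b = poly q x"
      by blast
    then show "a - b \<in> (\<lambda>p. poly p x) ` coeffs_in B" "a * b \<in> (\<lambda>p. poly p x) ` coeffs_in B"
      using image_eqI[of _ "\<lambda>p. poly p x" "p - q", OF _ coeffs_in_diff[of p q]]
        image_eqI[of _ "\<lambda>p. poly p x" "p * q", OF _ coeffs_in_mult[of p q]] by auto
  qed
  moreover have "x \<in> (\<lambda>p. poly p x) ` coeffs_in B"
    by (intro image_eqI[of _ _ "[:0, 1:]"] coeffs_in_closed) (auto intro: csubring_closed B)
  moreover have "b \<in> (\<lambda>p. poly p x) ` coeffs_in B" if "b \<in> B" for b
    using that by (intro image_eqI[of _ _ "[:b:]"] coeffs_in_closed) auto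
  ultimately show "ring_gen (insert x B) \<subseteq> (\<lambda>p. poly p x) ` coeffs_in B"
    by (intro ring_gen_minimal) auto
  show "(\<lambda>p. poly p x) ` coeffs_in B \<subseteq> ring_gen (insert x B)"
    using ring_gen_incl[of "insert x B"]
    by (auto intro!: poly_coeffs_in csubring_ring_gen)
qed

end

section \<open>Transcendental elements and independent lists\<close>

definition transc :: "'a::comm_ring_1 set \<Rightarrow> 'a \<Rightarrow> bool" where
  "transc B x \<longleftrightarrow> (\<forall>p\<in>coeffs_in B. poly p x = 0 \<longrightarrow> p = 0)"

lemma transcD: "transc B x \<Longrightarrow> p \<in> coeffs_in B \<Longrightarrow> poly p x = 0 \<Longrightarrow> p = 0"
  by (simp add: transc_def)

lemma transc_antimono: "B \<subseteq> C \<Longrightarrow> transc C x \<Longrightarrow> transc B x"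
  by (auto simp: transc_def coeffs_in_def)

text \<open>The last entry is transcendental over \<open>B\<close> itself, the head over everything
  after it. Generated rings suffice here, because passing to fraction fields does not affect
  transcendence (\<open>indep_frac\<close>).\<close>

fun indep :: "'a::comm_ring_1 set \<Rightarrow> 'a list \<Rightarrow> bool" where
  "indep B [] \<longleftrightarrow> True"
| "indep B (x # xs) \<longleftrightarrow> indep B xs \<and> transc (ring_gen (B \<union> set xs)) x"

lemma indep_append: "indep B (xs @ ys) \<longleftrightarrow> indep B ys \<and> indep (ring_gen (B \<union> set ys)) xs"
proof (induction xs)
  case (Cons x xs)
  have "ring_gen (ring_gen (B \<union> set ys) \<union> set xs) = ring_gen (B \<union> set (xs @ ys))"
    by (simp only: ring_gen_Un) (simp add: Un_ac)
  with Cons show ?case by auto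
qed simp

text \<open>Used to absorb the innermost element into the base, both in the exchange argument and in
  the localisation step.\<close>

lemma indep_snoc:
  assumes "csubring B"
  shows "indep B (xs @ [b]) \<longleftrightarrow> transc B b \<and> indep (ring_gen (insert b B)) xs"
  by (simp add: indep_append ring_gen_id assms)

section \<open>Ideals and chains of primes of a subring\<close>

definition ideal_in :: "'a::comm_ring_1 set \<Rightarrow> 'a set \<Rightarrow> bool" where
  "ideal_in A I \<longleftrightarrow> I \<subseteq> A \<and> 0 \<in> I \<and> (\<forall>a\<in>I. \<forall>b\<in>I. a + b \<in> I) \<and> (\<forall>a\<in>A. \<forall>b\<in>I. a * b \<in> I)"

lemma ideal_in_subset: "ideal_in A P \<Longrightarrow> a \<in> P \<Longrightarrow> a \<in> A"
  and ideal_in_0: "ideal_in A P \<Longrightarrow> 0 \<in> P"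
  and ideal_in_add: "ideal_in A P \<Longrightarrow> a \<in> P \<Longrightarrow> b \<in> P \<Longrightarrow> a + b \<in> P"
  and ideal_in_mult_left: "ideal_in A P \<Longrightarrow> a \<in> A \<Longrightarrow> b \<in> P \<Longrightarrow> a * b \<in> P"
  and ideal_in_mult_right: "ideal_in A P \<Longrightarrow> b \<in> P \<Longrightarrow> a \<in> A \<Longrightarrow> b * a \<in> P"
  by (auto simp: ideal_in_def mult.commute[of b a])

lemma ideal_in_uminus: "csubring A \<Longrightarrow> ideal_in A P \<Longrightarrow> a \<in> P \<Longrightarrow> - a \<in> P"
  using ideal_in_mult_left[of A P "- 1" a] by (auto intro: csubring_closed)

lemma ideal_in_diff: "csubring A \<Longrightarrow> ideal_in A P \<Longrightarrow> a \<in> P \<Longrightarrow> b \<in> P \<Longrightarrow> a - b \<in> P"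
  using ideal_in_add[of A P a "- b"] ideal_in_uminus[of A P b] by simp

definition prime_in :: "'a::comm_ring_1 set \<Rightarrow> 'a set \<Rightarrow> bool" where
  "prime_in A P \<longleftrightarrow> ideal_in A P \<and> 1 \<notin> P \<and> (\<forall>a\<in>A. \<forall>b\<in>A. a * b \<in> P \<longrightarrow> a \<in> P \<or> b \<in> P)"

definition prime_chain :: "'a::comm_ring_1 set \<Rightarrow> nat \<Rightarrow> (nat \<Rightarrow> 'a set) \<Rightarrow> bool" where
  "prime_chain A n P \<longleftrightarrow> (\<forall>i\<le>n. prime_in A (P i)) \<and> (\<forall>i<n. P i \<subset> P (Suc i))"

lemma prime_in_ideal: "prime_in A P \<Longrightarrow> ideal_in A P"
  and prime_in_1: "prime_in A P \<Longrightarrow> 1 \<notin> P"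
  and prime_in_mult: "prime_in A P \<Longrightarrow> a \<in> A \<Longrightarrow> b \<in> A \<Longrightarrow> a * b \<in> P \<Longrightarrow> a \<in> P \<or> b \<in> P"
  by (auto simp: prime_in_def)

lemma prime_in_power: "csubring A \<Longrightarrow> prime_in A P \<Longrightarrow> a \<in> A \<Longrightarrow> a ^ n \<in> P \<Longrightarrow> a \<in> P"
  by (induction n) (auto simp: prime_in_def intro: csubring_power)

lemma prime_in_Int:
  assumes "csubring A" "A \<subseteq> A'" "prime_in A' P"
  shows "prime_in A (P \<inter> A)"
  using assms by (auto simp: prime_in_def ideal_in_def subset_iff intro: csubring_closed)

lemma poly_in_ideal:
  assumes "csubring A" "ideal_in A P" "x \<in> A" "\<And>i. coeff p i \<in> P"
  shows "poly p x \<in> P"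
proof -
  have sum: "sum f I \<in> P" if "\<And>i. i \<in> I \<Longrightarrow> f i \<in> P" for f :: "nat \<Rightarrow> 'a" and I
    using that assms(2) by (induction I rule: infinite_finite_induct) (auto simp: ideal_in_def)
  have "coeff p i * x ^ i \<in> P" for i
    using ideal_in_mult_right[OF assms(2,4)] csubring_power[OF assms(1,3)] by blast
  then show ?thesis unfolding poly_altdef by (intro sum)
qed

text \<open>
  A polynomial relation \<open>p(f) = 0\<close> between \<open>f \<in> P\<^sub>i - P\<^sub>i\<^sub>-\<^sub>1\<close> and later elements of the chain can
  be divided by \<open>f\<close> modulo \<open>P\<^sub>i\<^sub>-\<^sub>1\<close> until its constant term is nonzero; that term then lies in \<open>P\<^sub>i\<close>.
\<close>

lemma prime_step_transc:
  fixes A :: "'a::idom set"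
  assumes A: "csubring A" and B: "csubring B" "B \<subseteq> A"
    and P: "prime_in A P" and Q: "prime_in A Q" "P \<subseteq> Q" and f: "f \<in> Q" "f \<notin> P"
    and BQ: "B \<inter> Q \<subseteq> {0}" and p: "p \<in> coeffs_in B" "poly p f \<in> P"
  shows "p = 0"
  using p
proof (induction p)
  case 0
  then show ?case by simp
next
  case (pCons a p)
  have a: "a \<in> B" and p: "p \<in> coeffs_in B"
    using pCons.prems(1) coeff_coeffs_in[OF pCons.prems(1), of 0]
    by (auto simp: coeffs_in_def coeff_pCons split: nat.splits)
  have fA: "f \<in> A" using f(1) Q(1) by (auto simp: prime_in_def ideal_in_def)
  have pA: "poly p f \<in> A" using p B A fA by (intro poly_coeffs_in[of B])
  have 1: "a + f * poly p f \<in> P" using pCons.prems(2) by simp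
  have 2: "- (f * poly p f) \<in> Q"
    using f(1) pA Q(1) csubring_uminus[OF A pA] unfolding prime_in_def ideal_in_def
    by (metis mult.commute mult_minus_right)
  have "a = (a + f * poly p f) + (- (f * poly p f))" by simp
  moreover have "\<dots> \<in> Q" using 1 2 Q unfolding prime_in_def ideal_in_def by blast
  ultimately have "a \<in> B \<inter> Q" using a by simp
  with BQ have a0: "a = 0" by blast
  with 1 have "f * poly p f \<in> P" by simp
  with P f(2) fA pA have "poly p f \<in> P" by (auto simp: prime_in_def)
  with pCons.IH[OF p] a0 show ?case by simp
qed

text \<open>The chain is descended from its top. The invariant is that the ring generated by the
  elements found so far meets the current prime only in 0; it starts with
  \<open>F \<inter> P n\<close>.\<close>

lemma prime_chain_indep:
  fixes A :: "'a::idom set"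
  assumes A: "csubring A" and F: "csubring F" "F \<subseteq> A" and P: "prime_chain A n P"
    and FP: "F \<inter> P n \<subseteq> {0}"
  shows "\<exists>fs. set fs \<subseteq> A \<and> length fs = n \<and> indep F fs"
proof -
  have "\<exists>fs. set fs \<subseteq> A \<and> length fs = k \<and> indep F fs \<and> ring_gen (F \<union> set fs) \<inter> P (n - k) \<subseteq> {0}"
    if "k \<le> n" for k
    using that
  proof (induction k)
    case 0
    show ?case using FP F by (intro exI[of _ "[]"]) (auto simp: ring_gen_id)
  next
    case (Suc k)
    then obtain fs where fs: "set fs \<subseteq> A" "length fs = k" "indep F fs"
      and 0: "ring_gen (F \<union> set fs) \<inter> P (n - k) \<subseteq> {0}" by auto
    let ?B = "ring_gen (F \<union> set fs)"
    have Suc_eq: "Suc (n - Suc k) = n - k" using Suc.prems by simp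
    have pr: "prime_in A (P (n - Suc k))" "prime_in A (P (n - k))"
      using P by (auto simp: prime_chain_def)
    have "n - Suc k < n" using Suc.prems by simp
    then have sub: "P (n - Suc k) \<subset> P (n - k)"
      using P Suc_eq unfolding prime_chain_def by metis
    then obtain f where f: "f \<in> P (n - k)" "f \<notin> P (n - Suc k)" by blast
    have fA: "f \<in> A" using f pr by (auto simp: prime_in_def ideal_in_def)
    have BA: "?B \<subseteq> A" using F fs A by (intro ring_gen_minimal) auto
    \<comment> \<open>Allowing values in the lower prime, and not only the value 0, yields both
      conclusions at once: transcendence of \<open>f\<close>, and the invariant for the next
      prime.\<close>
    have step: "p = 0" if "p \<in> coeffs_in ?B" "poly p f \<in> P (n - Suc k)" for p
      using prime_step_transc[OF A csubring_ring_gen BA pr _ f 0 that] sub by blast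
    have "0 \<in> P (n - Suc k)" using pr by (auto simp: prime_in_def ideal_in_def)
    then have "transc ?B f" using step unfolding transc_def by metis
    moreover have "ring_gen (F \<union> set (f # fs)) \<inter> P (n - Suc k) \<subseteq> {0}"
    proof
      fix x assume x: "x \<in> ring_gen (F \<union> set (f # fs)) \<inter> P (n - Suc k)"
      then have "x \<in> ring_gen (insert f ?B)" by (simp add: ring_gen_insert_ring_gen)
      then obtain p where p: "p \<in> coeffs_in ?B" "x = poly p f"
        using ring_gen_insert[OF csubring_ring_gen] by blast
      with step[of p] x show "x \<in> {0}" by auto
    qed
    ultimately show ?case using fs fA by (intro exI[of _ "f # fs"]) auto
  qed
  from this[of n] show ?thesis by auto
qed

section \<open>Zariski's lemma by Goldman descent\<close>

context
  fixes A P :: "'a::comm_ring_1 set"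
  assumes A: "csubring A" and P: "ideal_in A P"
begin

lemma cong_sym: "a - b \<in> P \<Longrightarrow> b - a \<in> P"
  using ideal_in_uminus[OF A P, of "a - b"] by simp

lemma cong_trans: "a - b \<in> P \<Longrightarrow> b - c \<in> P \<Longrightarrow> a - c \<in> P"
  using ideal_in_add[OF P, of "a - b" "b - c"] by simp

lemma cong_mult:
  assumes "a - b \<in> P" "c - d \<in> P" "b \<in> A" "c \<in> A"
  shows "a * c - b * d \<in> P"
proof -
  have "(a - b) * c + b * (c - d) \<in> P"
    using assms by (intro ideal_in_add[OF P] ideal_in_mult_left[OF P] ideal_in_mult_right[OF P])
  then show ?thesis by (simp add: algebra_simps)
qed

lemma cong_power: "a - b \<in> P \<Longrightarrow> a \<in> A \<Longrightarrow> b \<in> A \<Longrightarrow> a ^ n - b ^ n \<in> P"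
proof (induction n)
  case (Suc n)
  then show ?case using cong_mult[of a b "a ^ n" "b ^ n"] csubring_power[OF A] by auto
qed (simp add: ideal_in_0[OF P])

lemma cong_mem: "a - b \<in> P \<Longrightarrow> b \<in> P \<Longrightarrow> a \<in> P"
  using ideal_in_add[OF P, of "a - b" b] by simp

end

text \<open>The leading coefficient of \<open>f\<close> need not be invertible in \<open>B\<close>,
  so each cancellation of the top term costs one factor \<open>lead_coeff f\<close>. The alternative
  \<open>r = 0\<close> covers constant \<open>f\<close>.\<close>

lemma pseudo_division:
  fixes h f :: "'a::idom poly"
  assumes B: "csubring B" and h: "h \<in> coeffs_in B" and f: "f \<in> coeffs_in B" "f \<noteq> 0"
  shows "\<exists>k. \<exists>q\<in>coeffs_in B. \<exists>r\<in>coeffs_in B.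
    smult (lead_coeff f ^ k) h = q * f + r \<and> (r = 0 \<or> degree r < degree f)"
  using h
proof (induction "degree h" arbitrary: h rule: less_induct)
  case less
  show ?case
  proof (cases "h = 0 \<or> degree h < degree f")
    case True
    then show ?thesis using less.prems coeffs_in_0[OF B]
      by (intro exI[of _ 0] bexI[of _ 0] bexI[of _ h]) auto
  next
    case False
    define c where "c = monom (lead_coeff h) (degree h - degree f)"
    define h' where "h' = smult (lead_coeff f) h - c * f"
    have c: "c \<in> coeffs_in B"
      using less.prems by (auto simp: c_def intro!: coeffs_in_monom B coeff_coeffs_in)
    have h': "h' \<in> coeffs_in B"
      using less.prems c f B by (auto simp: h'_def intro!: coeffs_in_closed coeff_coeffs_in)
    have deg: "degree (smult (lead_coeff f) h) \<le> degree h" "degree (c * f) \<le> degree h"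
      using False f by (auto simp: c_def degree_mult_eq degree_monom_eq)
    have "coeff (c * f) (degree h) = lead_coeff h * lead_coeff f"
      using False by (simp add: c_def coeff_monom_mult)
    then have "coeff h' (degree h) = 0" by (simp add: h'_def)
    moreover have "degree h' \<le> degree h" unfolding h'_def using deg by (intro degree_diff_le)
    ultimately have "h' = 0 \<or> degree h' < degree h"
      by (metis le_neq_implies_less leading_coeff_0_iff)
    then obtain k q r where qr: "q \<in> coeffs_in B" "r \<in> coeffs_in B" "r = 0 \<or> degree r < degree f"
      and eq: "smult (lead_coeff f ^ k) h' = q * f + r"
    proof
      assume "h' = 0"
      then show ?thesis using that[of 0 0 0] coeffs_in_0[OF B] by simp
    next
      assume "degree h' < degree h"
      from less.hyps[OF this h'] that show ?thesis by blast
    qed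
    have "smult (lead_coeff f ^ Suc k) h = smult (lead_coeff f ^ k) (h' + c * f)"
      by (simp add: h'_def mult.commute)
    also have "\<dots> = (q + smult (lead_coeff f ^ k) c) * f + r"
      using eq by (simp add: smult_add_right algebra_simps)
    finally have "smult (lead_coeff f ^ Suc k) h = (q + smult (lead_coeff f ^ k) c) * f + r" .
    moreover have "q + smult (lead_coeff f ^ k) c \<in> coeffs_in B"
      using qr c f B by (auto intro!: coeffs_in_closed coeff_coeffs_in csubring_power)
    ultimately show ?thesis using qr by blast
  qed
qed

text \<open>
  \<open>goldman B P\<close> says that the domain \<open>B/P\<close> becomes a field after inverting a single element.
\<close>

definition goldman :: "'a::comm_ring_1 set \<Rightarrow> 'a set \<Rightarrow> bool" where
  "goldman B P \<longleftrightarrow> (\<exists>s\<in>B - P. \<forall>u\<in>B - P. \<exists>c\<in>B. \<exists>m. u * c - s ^ m \<in> P)"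

text \<open>Normal form for polynomials over \<open>B/P\<close>: once the coefficients in
  \<open>P\<close> are cleared, a nonzero polynomial has a leading coefficient outside
  \<open>P\<close>, so its degree is its true degree modulo \<open>P\<close>.\<close>

definition reduced :: "'a::zero set \<Rightarrow> 'a poly \<Rightarrow> bool" where
  "reduced P f \<longleftrightarrow> (\<forall>i. coeff f i \<in> P \<longrightarrow> coeff f i = 0)"

context
  fixes B C P :: "'a::idom set" and g :: 'a
  assumes B: "csubring B" and C: "C = ring_gen (insert g B)" and P: "prime_in C P"
begin

lemma adjoin_csubring: "csubring C" and adjoin_base: "B \<subseteq> C" and adjoin_gen: "g \<in> C"
  using ring_gen_incl[of "insert g B"] by (auto simp: C csubring_ring_gen)

lemma adjoin_poly: "p \<in> coeffs_in B \<Longrightarrow> poly p g \<in> C"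
  using adjoin_csubring adjoin_base adjoin_gen by (intro poly_coeffs_in[OF B])

lemma exists_reduced:
  assumes p: "p \<in> coeffs_in B"
  obtains q where "q \<in> coeffs_in B" "reduced P q" "\<And>i. coeff (p - q) i \<in> P"
    "poly p g - poly q g \<in> P" "degree q \<le> degree p"
proof -
  define q where "q = map_poly (\<lambda>c. if c \<in> P then 0 else c) p"
  have q: "coeff q i = (if coeff p i \<in> P then 0 else coeff p i)" for i
    by (simp add: q_def coeff_map_poly)
  have *: "coeff (p - q) i \<in> P" for i
    using ideal_in_0[OF prime_in_ideal[OF P]] by (simp add: q)
  from poly_in_ideal[OF adjoin_csubring prime_in_ideal[OF P] adjoin_gen this]
  have "poly p g - poly q g \<in> P" by simp
  moreover have "q \<in> coeffs_in B" using p csubring_0[OF B] by (simp add: coeffs_in_def q)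
  moreover have "degree q \<le> degree p" by (simp add: q_def degree_map_poly_le)
  ultimately show ?thesis using * q by (intro that[of q]) (auto simp: reduced_def)
qed

lemma adjoin_repr:
  assumes "a \<in> C"
  obtains p where "p \<in> coeffs_in B" "reduced P p" "a - poly p g \<in> P"
proof -
  obtain p where "p \<in> coeffs_in B" "a = poly p g"
    using assms ring_gen_insert[OF B, of g] C by auto
  then show ?thesis using exists_reduced[of p] that by metis
qed

lemma reduced_lead: "reduced P f \<Longrightarrow> f \<noteq> 0 \<Longrightarrow> lead_coeff f \<notin> P"
  by (auto simp: reduced_def)

text \<open>
  Euclid's argument: if \<open>B[g]/P\<close> were a polynomial ring in \<open>g\<close> and inverting \<open>s\<close> made it a field,
  then \<open>1 + g s\<close>, being prime to \<open>s\<close>, would be a unit of positive degree.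
\<close>

lemma goldman_imp_algebraic:
  assumes "goldman C P"
  shows "\<exists>f\<in>coeffs_in B. f \<noteq> 0 \<and> reduced P f \<and> poly f g \<in> P"
proof (rule ccontr)
  assume no: "\<not> ?thesis"
  note I = prime_in_ideal[OF P] and CR = adjoin_csubring
  have no: "f = 0" if "f \<in> coeffs_in B" "reduced P f" "poly f g \<in> P" for f
    using no that by blast
  obtain s where s: "s \<in> C" "s \<notin> P" and inv: "\<And>u. u \<in> C - P \<Longrightarrow> \<exists>c\<in>C. \<exists>m. u * c - s ^ m \<in> P"
    using assms by (auto simp: goldman_def)
  obtain S where S: "S \<in> coeffs_in B" "reduced P S" "s - poly S g \<in> P" using adjoin_repr[OF s(1)] .
  have S0: "S \<noteq> 0" using S(3) s(2) by auto
  define s' where "s' = poly S g"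
  \<comment> \<open>\<open>U\<close> is \<open>1 + X * S\<close>. It has positive degree since
    \<open>S \<noteq> 0\<close>, and it stays reduced because its new constant term 1 is not in
    \<open>P\<close>.\<close>
  define U where "U = pCons 1 S"
  have s'C: "s' \<in> C" unfolding s'_def by (rule adjoin_poly[OF S(1)])
  have U: "U \<in> coeffs_in B" "reduced P U" "U \<noteq> 0"
    using S B csubring_1[OF B] prime_in_1[OF P]
    by (auto simp: U_def reduced_def coeff_pCons intro: coeffs_in_pCons split: nat.splits)
  have Ug: "poly U g = 1 + g * s'" by (simp add: U_def s'_def)
  have "poly U g \<in> C - P" using no[OF U(1,2)] U adjoin_poly[OF U(1)] by blast
  then obtain c m where c: "c \<in> C" and cm: "poly U g * c - s ^ m \<in> P" using inv by blast
  have "poly U g * c - s' ^ m \<in> P"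
    using cong_power[OF CR I S(3), of m] s s'C
    by (intro cong_trans[OF CR I cm]) (simp add: s'_def)
  then have 1: "(- g) ^ m * (poly U g * c - s' ^ m) \<in> P"
    by (rule ideal_in_mult_left[OF I csubring_power[OF CR csubring_uminus[OF CR adjoin_gen]]])
  \<comment> \<open>The element \<open>1 + g s'\<close> divides a power of \<open>s'\<close> modulo
    \<open>P\<close>, and by the geometric sum it divides \<open>1 - (- g s') ^ m\<close>. Adding
    the first relation, scaled by \<open>(- g) ^ m\<close>, exhibits an inverse of it modulo
    \<open>P\<close>.\<close>
  have "1 - (- g * s') ^ m = poly U g * (\<Sum>i<m. (- g * s') ^ i)"
    using one_diff_power_eq[of "- g * s'" m] by (simp add: Ug)
  then have 2: "(- g) ^ m * (poly U g * c - s' ^ m) =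
      poly U g * ((- g) ^ m * c + (\<Sum>i<m. (- g * s') ^ i)) - 1"
    by (simp add: algebra_simps power_mult_distrib flip: power_mult_distrib)
  have "(- g) ^ m * c + (\<Sum>i<m. (- g * s') ^ i) \<in> C"
    using CR adjoin_gen c s'C by (intro csubring_closed)
  then obtain D where D: "D \<in> coeffs_in B" "reduced P D"
      "(- g) ^ m * c + (\<Sum>i<m. (- g * s') ^ i) - poly D g \<in> P"
    by (rule adjoin_repr)
  define W where "W = U * D - 1"
  have W: "W \<in> coeffs_in B" using U D B by (simp add: W_def coeffs_in_closed)
  have "poly U g * poly D g - 1 \<in> P"
  proof (rule cong_trans[OF CR I])
    show "poly U g * ((- g) ^ m * c + (\<Sum>i<m. (- g * s') ^ i)) - 1 \<in> P" using 1 2 by simp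
    have "poly U g * (poly D g - ((- g) ^ m * c + (\<Sum>i<m. (- g * s') ^ i))) \<in> P"
      by (rule ideal_in_mult_left[OF I adjoin_poly[OF U(1)] cong_sym[OF CR I D(3)]])
    then show "poly U g * poly D g - poly U g * ((- g) ^ m * c + (\<Sum>i<m. (- g * s') ^ i)) \<in> P"
      by (simp add: algebra_simps)
  qed
  then have WP: "poly W g \<in> P" by (simp add: W_def)
  obtain W' where W': "W' \<in> coeffs_in B" "reduced P W'" "\<And>i. coeff (W - W') i \<in> P"
      "poly W g - poly W' g \<in> P" using exists_reduced[OF W] by metis
  have "poly W' g \<in> P" using cong_mem[OF CR I cong_sym[OF CR I W'(4)] WP] .
  then have "W' = 0" using no W' by blast
  with W'(3) have coW: "coeff W i \<in> P" for i by (metis diff_zero)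
  show False
  proof (cases "D = 0")
    case True
    with coW[of 0] have "- 1 \<in> P" by (simp add: W_def)
    then show False using ideal_in_uminus[OF CR I, of "- 1"] prime_in_1[OF P] by simp
  next
    case False
    have dU: "degree U = Suc (degree S)" using S0 by (simp add: U_def)
    \<comment> \<open>Since \<open>U\<close> has positive degree, subtracting 1 leaves the top
      coefficient of \<open>U * D\<close> unchanged.\<close>
    have "coeff W (degree U + degree D) = lead_coeff U * lead_coeff D"
      using coeff_mult_degree_sum[of U D] by (simp add: W_def dU)
    with coW have "lead_coeff U * lead_coeff D \<in> P" by metis
    then have "lead_coeff U \<in> P \<or> lead_coeff D \<in> P"
      using U D adjoin_base by (intro prime_in_mult[OF P]) (auto intro: coeff_coeffs_in)
    then show False using reduced_lead U D False by blast
  qed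
qed

end

text \<open>
  With \<open>f\<close> a minimal polynomial of \<open>g\<close> modulo \<open>P\<close>, a multiple of \<open>s\<close> of least degree in \<open>g\<close> must be a
  constant \<open>b \<in> B\<close>, and \<open>b\<close> times the leading coefficient of \<open>f\<close> is the element to invert in \<open>B\<close>.
\<close>

lemma goldman_descent:
  fixes B C P :: "'a::idom set"
  assumes B: "csubring B" and C: "C = ring_gen (insert g B)" and P: "prime_in C P"
    and G: "goldman C P"
  shows "goldman B P"
proof -
  note I = prime_in_ideal[OF P] and CR = adjoin_csubring[OF B C P]
  note BC = subsetD[OF adjoin_base[OF B C P]] and poly_C = adjoin_poly[OF B C P]
  note trans = cong_trans[OF CR I] and sym = cong_sym[OF CR I] and mem = cong_mem[OF CR I]
  obtain s where s: "s \<in> C" "s \<notin> P" and inv: "\<And>u. u \<in> C - P \<Longrightarrow> \<exists>c\<in>C. \<exists>m. u * c - s ^ m \<in> P"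
    using G by (auto simp: goldman_def)
  define rel where "rel f \<longleftrightarrow> f \<in> coeffs_in B \<and> f \<noteq> 0 \<and> reduced P f \<and> poly f g \<in> P" for f
  have "\<exists>f. rel f" using goldman_imp_algebraic[OF B C P G] by (auto simp: rel_def)
  then obtain f where f: "rel f" and f_min: "\<And>h. rel h \<Longrightarrow> degree f \<le> degree h"
    using ex_has_least_nat[of rel _ degree] by blast
  have fB: "f \<in> coeffs_in B" "f \<noteq> 0" "poly f g \<in> P" using f by (auto simp: rel_def)
  define l where "l = lead_coeff f"
  have lB: "l \<in> B" and lP: "l \<notin> P"
    using f reduced_lead[OF B C P] coeff_coeffs_in[OF fB(1)] by (auto simp: rel_def l_def)
  have deg_f: "degree f > 0"
  proof (rule ccontr)
    assume "\<not> ?thesis"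
    then have "poly f g = l" by (auto simp: l_def elim: degree_eq_zeroE)
    then show False using f lP by (auto simp: rel_def)
  qed
  \<comment> \<open>By minimality of \<open>f\<close>, the powers of \<open>g\<close> below
    \<open>degree f\<close> are linearly independent over \<open>B/P\<close>: the reduced form of
    \<open>h\<close> would otherwise be a relation of smaller degree.\<close>
  have small: "coeff h i \<in> P" if h: "h \<in> coeffs_in B" "poly h g \<in> P" "h = 0 \<or> degree h < degree f" for h i
  proof -
    obtain q where q: "q \<in> coeffs_in B" "reduced P q" "\<And>i. coeff (h - q) i \<in> P"
        "poly h g - poly q g \<in> P" "degree q \<le> degree h"
      using exists_reduced[OF B C P h(1)] by metis
    have "q = 0"
    proof (rule ccontr)
      assume "q \<noteq> 0"
      moreover have "poly q g \<in> P" using mem[OF sym[OF q(4)] h(2)] .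
      ultimately have "rel q" using q by (simp add: rel_def)
      then have "degree f \<le> degree h" using f_min q(5) by fastforce
      with h(3) have "h = 0" by simp
      with q(5) \<open>degree f \<le> degree h\<close> deg_f show False by simp
    qed
    then show ?thesis using q(3)[of i] by simp
  qed
  have unit_mult: "x * y \<notin> P" if "x \<in> C" "y \<in> C" "x \<notin> P" "y \<notin> P" for x y
    using prime_in_mult[OF P that(1,2)] that by blast
  \<comment> \<open>\<open>good S\<close> says that the value of \<open>S\<close> at
    \<open>g\<close> is, modulo \<open>P\<close>, a nonzero multiple of \<open>s\<close>. By
    \<open>goodI\<close> this passes to any polynomial whose value is a nonzero multiple of that of
    \<open>S\<close>.\<close>
  define good where "good S \<longleftrightarrow> S \<in> coeffs_in B \<and> poly S g \<notin> P \<and> (\<exists>w\<in>C. poly S g - s * w \<in> P)" for S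
  have goodI: "good r"
    if r: "good S" "r \<in> coeffs_in B" "poly r g \<notin> P" "v \<in> C" "poly r g - poly S g * v \<in> P" for S r v
  proof -
    obtain w where w: "w \<in> C" "poly S g - s * w \<in> P" using r(1) unfolding good_def by blast
    have "poly S g * v - s * w * v \<in> P" using ideal_in_mult_right[OF I w(2) r(4)]
      by (simp add: algebra_simps)
    from trans[OF r(5) this] have "poly r g - s * (w * v) \<in> P" by (simp add: mult.assoc)
    then show ?thesis using r w csubring_mult[OF CR] unfolding good_def by blast
  qed
  have "\<exists>S. good S"
  proof -
    obtain S where S: "S \<in> coeffs_in B" "s - poly S g \<in> P" using adjoin_repr[OF B C P s(1)] by metis
    then have "poly S g \<notin> P" using mem s(2) by blast
    moreover have "poly S g - s * 1 \<in> P" using sym[OF S(2)] by simp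
    ultimately show ?thesis using S csubring_1[OF CR] unfolding good_def by blast
  qed
  then obtain S0 where S0: "good S0" and S0_min: "\<And>h. good h \<Longrightarrow> degree S0 \<le> degree h"
    using ex_has_least_nat[of good _ degree] by blast
  obtain S where S: "S \<in> coeffs_in B" "reduced P S" "poly S0 g - poly S g \<in> P" "degree S \<le> degree S0"
    using exists_reduced[OF B C P] S0 unfolding good_def by metis
  have "poly S g \<notin> P" using mem[OF S(3)] S0 unfolding good_def by blast
  moreover have "poly S g - poly S0 g * 1 \<in> P" using sym[OF S(3)] by simp
  ultimately have goodS: "good S" using goodI[OF S0 S(1)] csubring_1[OF CR] by blast
  have S_min: "degree S \<le> degree h" if "good h" for h using S0_min[OF that] S(4) by simp
  have S_nz: "S \<noteq> 0" using goodS ideal_in_0[OF I] by (auto simp: good_def)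
  \<comment> \<open>Otherwise the pseudo-remainder of \<open>S\<close> by \<open>f\<close> would be
    good and of smaller degree: its value is \<open>l ^ k\<close> times that of \<open>S\<close>,
    since \<open>f\<close> vanishes at \<open>g\<close>.\<close>
  have Sf: "degree S < degree f"
  proof (rule ccontr)
    assume ge: "\<not> ?thesis"
    obtain k q r where q: "q \<in> coeffs_in B" "r \<in> coeffs_in B" "r = 0 \<or> degree r < degree f"
      and eq: "smult (l ^ k) S = q * f + r"
      using pseudo_division[OF B S(1) fB(1,2)] unfolding l_def by blast
    have lk: "l ^ k \<in> C" "l ^ k \<notin> P"
      using lB lP prime_in_power[OF CR P, of l k] BC CR by (auto intro: csubring_power)
    have "l ^ k * poly S g = poly q g * poly f g + poly r g" using arg_cong[OF eq, of "\<lambda>p. poly p g"] by simp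
    then have cong: "poly r g - poly S g * l ^ k = - (poly q g * poly f g)" by (simp add: algebra_simps)
    have "- (poly q g * poly f g) \<in> P"
      by (rule ideal_in_uminus[OF CR I ideal_in_mult_left[OF I poly_C[OF q(1)] fB(3)]])
    with cong have cong: "poly r g - poly S g * l ^ k \<in> P" by simp
    have "poly S g * l ^ k \<notin> P"
      using unit_mult[OF poly_C[OF S(1)] lk(1) _ lk(2)] goodS by (simp add: good_def)
    then have "poly r g \<notin> P" using mem[OF sym[OF cong]] by blast
    from goodI[OF goodS q(2) this lk(1) cong] have "degree S \<le> degree r" by (rule S_min)
    with q(3) ge have "r = 0" by simp
    with \<open>poly r g \<notin> P\<close> ideal_in_0[OF I] show False by simp
  qed
  \<comment> \<open>Now \<open>f\<close> is divided by \<open>S\<close>. Minimality of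
    \<open>S\<close> forces the remainder, and hence the quotient, to vanish at \<open>g\<close>
    modulo \<open>P\<close>. If \<open>S\<close> were not constant, both would have degree below
    \<open>degree f\<close>, so \<open>small\<close> would put all their coefficients in
    \<open>P\<close>, and with them the top coefficient \<open>m ^ k * l\<close> of the scaled
    \<open>f\<close>.\<close>
  have deg_S: "degree S = 0"
  proof (rule ccontr)
    assume pos: "degree S \<noteq> 0"
    define m where "m = lead_coeff S"
    have mB: "m \<in> B" and mP: "m \<notin> P"
      using S S_nz reduced_lead[OF B C P S(2)] coeff_coeffs_in[OF S(1)] by (auto simp: m_def)
    obtain k q r where q: "q \<in> coeffs_in B" "r \<in> coeffs_in B" "r = 0 \<or> degree r < degree S"
      and eq: "smult (m ^ k) f = q * S + r"
      using pseudo_division[OF B fB(1) S(1) S_nz] unfolding m_def by blast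
    have mk: "m ^ k \<in> C" "m ^ k \<notin> P" "m \<noteq> 0"
      using mB mP prime_in_power[OF CR P, of m k] BC CR ideal_in_0[OF I] by (auto intro: csubring_power)
    have ev: "m ^ k * poly f g = poly q g * poly S g + poly r g"
      using arg_cong[OF eq, of "\<lambda>p. poly p g"] by simp
    have mf: "m ^ k * poly f g \<in> P" by (rule ideal_in_mult_left[OF I mk(1) fB(3)])
    have "poly r g - poly S g * (- poly q g) \<in> P" using mf ev by (simp add: algebra_simps)
    then have "good r" if "poly r g \<notin> P"
      using goodI[OF goodS q(2) that csubring_uminus[OF CR poly_C[OF q(1)]]] by blast
    then have rP: "poly r g \<in> P" using S_min[of r] q(3) ideal_in_0[OF I] by fastforce
    have "poly q g * poly S g \<in> P" using ideal_in_diff[OF CR I mf rP] ev by simp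
    then have qP: "poly q g \<in> P"
      using prime_in_mult[OF P poly_C[OF q(1)] poly_C[OF S(1)]] goodS by (auto simp: good_def)
    have "q = 0 \<or> degree q < degree f"
    proof (rule ccontr)
      assume n: "\<not> ?thesis"
      then have "degree (q * S) = degree q + degree S" using S_nz by (simp add: degree_mult_eq)
      moreover have "degree r < degree (q * S)" using q(3) calculation pos by auto
      then have "degree (q * S + r) = degree (q * S)" by (rule degree_add_eq_left)
      moreover have "degree (q * S + r) = degree f" using mk(3) by (simp flip: eq)
      ultimately show False using n pos by simp
    qed
    then have qc: "coeff q i \<in> P" for i using small[OF q(1) qP] by blast
    have rc: "coeff r i \<in> P" for i using small[OF q(2) rP] q(3) Sf by force
    have sumP: "sum h J \<in> P" if "\<And>i. i \<in> J \<Longrightarrow> h i \<in> P" for h :: "nat \<Rightarrow> 'a" and J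
      using that ideal_in_0[OF I] ideal_in_add[OF I]
      by (induction J rule: infinite_finite_induct) auto
    have "coeff (q * S) i \<in> P" for i
      unfolding coeff_mult
      by (rule sumP) (rule ideal_in_mult_right[OF I qc BC[OF coeff_coeffs_in[OF S(1)]]])
    then have "coeff (q * S + r) (degree f) \<in> P" using rc ideal_in_add[OF I] by simp
    then have "m ^ k * l \<in> P" by (simp add: l_def flip: eq)
    then show False using unit_mult[OF mk(1) BC[OF lB] mk(2) lP] by blast
  qed
  then obtain b where b: "S = [:b:]" by (rule degree_eq_zeroE)
  have bB: "b \<in> B" using coeff_coeffs_in[OF S(1), of 0] by (simp add: b)
  obtain w where bP: "b \<notin> P" and w: "w \<in> C" "b - s * w \<in> P" using goodS by (auto simp: good_def b)
  define t where "t = l * b"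
  have "\<exists>c\<in>B. \<exists>m. u * c - t ^ m \<in> P" if u: "u \<in> B - P" for u
  proof -
    obtain c m where c: "c \<in> C" "u * c - s ^ m \<in> P" using inv[of u] u BC by blast
    have uC: "u \<in> C" using u BC by blast
    have pw: "w ^ m \<in> C" "s ^ m \<in> C" "c * w ^ m \<in> C" "s * w \<in> C"
      using w s c CR by (simp_all add: csubring_closed)
    have "u * c * w ^ m - s ^ m * w ^ m \<in> P"
      using ideal_in_mult_right[OF I c(2) pw(1)] by (simp add: algebra_simps)
    moreover have "s ^ m * w ^ m - b ^ m \<in> P"
      using cong_power[OF CR I sym[OF w(2)] pw(4) BC[OF bB], of m] by (simp add: power_mult_distrib)
    ultimately have 1: "u * c * w ^ m - b ^ m \<in> P" by (rule trans)
    obtain h where h: "h \<in> coeffs_in B" "c * w ^ m - poly h g \<in> P"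
      using adjoin_repr[OF B C P pw(3)] by metis
    obtain k q r where q: "q \<in> coeffs_in B" "r \<in> coeffs_in B" "r = 0 \<or> degree r < degree f"
      and eq: "smult (l ^ k) h = q * f + r"
      using pseudo_division[OF B h(1) fB(1,2)] unfolding l_def by blast
    have lk: "l ^ k \<in> B" "l ^ k \<in> C" using lB B BC by (auto intro: csubring_power)
    have bm: "b ^ m \<in> B" using bB B by (rule csubring_power[rotated])
    \<comment> \<open>The value of \<open>r\<close> at \<open>g\<close> represents
      \<open>l ^ k\<close> times the cofactor \<open>c * w ^ m\<close> of \<open>u\<close>, so
      \<open>H\<close> vanishes at \<open>g\<close> modulo \<open>P\<close>. Its degree is below
      that of \<open>f\<close>, hence already its constant coefficient is a congruence between
      elements of \<open>B\<close>.\<close>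
    define H where "H = [:l ^ k * b ^ m:] - smult u r"
    have H: "H \<in> coeffs_in B"
      unfolding H_def using lk bm u q B by (intro coeffs_in_closed csubring_mult) auto
    have "l ^ k * poly h g = poly q g * poly f g + poly r g"
      using arg_cong[OF eq, of "\<lambda>p. poly p g"] by simp
    then have "poly H g = u * (poly q g * poly f g) - l ^ k * (u * c * w ^ m - b ^ m)
        + l ^ k * u * (c * w ^ m - poly h g)"
      unfolding H_def by (simp add: algebra_simps)
    moreover have "u * (poly q g * poly f g) - l ^ k * (u * c * w ^ m - b ^ m)
        + l ^ k * u * (c * w ^ m - poly h g) \<in> P"
      by (rule ideal_in_add[OF I ideal_in_diff[OF CR I]])
        (rule ideal_in_mult_left[OF I] poly_C q fB 1 lk uC h csubring_mult[OF CR])+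
    ultimately have "poly H g \<in> P" by simp
    moreover have "degree H < degree f"
    proof -
      have "degree (smult u r) < degree f" using q(3) deg_f by auto
      then show ?thesis unfolding H_def using deg_f by (intro degree_diff_less) auto
    qed
    ultimately have "coeff H 0 \<in> P" using small[OF H] by blast
    then have "l ^ k * b ^ m - u * coeff r 0 \<in> P" by (simp add: H_def)
    \<comment> \<open>The factor makes the exponents of \<open>l\<close> and \<open>b\<close> equal,
      which gives a power of the single element \<open>t = l * b\<close>.\<close>
    then have "(l ^ m * b ^ k) * (l ^ k * b ^ m - u * coeff r 0) \<in> P"
      by (rule ideal_in_mult_left[OF I BC[OF csubring_mult[OF B csubring_power[OF B lB] csubring_power[OF B bB]]]])
    then have "t ^ (k + m) - u * (l ^ m * b ^ k * coeff r 0) \<in> P"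
      by (simp add: t_def algebra_simps power_add power_mult_distrib)
    moreover have "l ^ m * b ^ k * coeff r 0 \<in> B"
      using lB bB B coeff_coeffs_in[OF q(2)] by (auto intro: csubring_closed)
    ultimately show ?thesis using sym by blast
  qed
  moreover have "t \<in> B - P"
    using unit_mult[OF BC[OF lB] BC[OF bB] lP bP] csubring_mult[OF B lB bB] by (simp add: t_def)
  ultimately show ?thesis unfolding goldman_def by blast
qed

text \<open>Only the trace of \<open>P\<close> on \<open>B\<close> matters, because
  \<open>u * c - s ^ m\<close> lies in \<open>B\<close>.\<close>

lemma goldman_Int: "csubring B \<Longrightarrow> goldman B P \<Longrightarrow> goldman B (P \<inter> B)"
  unfolding goldman_def
  by (metis (no_types, lifting) DiffD1 DiffD2 DiffI IntD1 IntI csubring_diff csubring_mult csubring_power)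

text \<open>The substitute for Zariski's lemma. The prime is contracted after each generator is
  removed, so that it is again a prime of the ring from which the next descent starts.\<close>

lemma goldman_descent_list:
  fixes B P :: "'a::idom set"
  assumes B: "csubring B" and P: "prime_in (ring_gen (B \<union> set gs)) P"
    and G: "goldman (ring_gen (B \<union> set gs)) P"
  shows "goldman B P"
  using P G
proof (induction gs arbitrary: P)
  case Nil
  then show ?case using B by (simp add: ring_gen_id)
next
  case (Cons g gs)
  let ?B = "ring_gen (B \<union> set gs)"
  have C: "ring_gen (B \<union> set (g # gs)) = ring_gen (insert g ?B)"
    by (simp add: ring_gen_insert_ring_gen)
  have "goldman ?B (P \<inter> ?B)"
    using goldman_descent[OF csubring_ring_gen C Cons.prems] goldman_Int[OF csubring_ring_gen] by blast
  moreover have "prime_in ?B (P \<inter> ?B)"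
    by (rule prime_in_Int[OF csubring_ring_gen ring_gen_mono Cons.prems(1)]) auto
  ultimately have "goldman B (P \<inter> ?B)" using Cons.IH by blast
  moreover have "B \<subseteq> ?B" using ring_gen_incl[of "B \<union> set gs"] by blast
  ultimately show ?case unfolding goldman_def by blast
qed

section \<open>Algebraic closure and exchange\<close>

definition frac :: "'a::field set \<Rightarrow> 'a set" where
  "frac B = {a / b | a b. a \<in> B \<and> b \<in> B \<and> b \<noteq> 0}"

context
  fixes B :: "'a::field set"
  assumes B: "csubring B"
begin

lemma frac_incl: "B \<subseteq> frac B"
proof
  fix a assume "a \<in> B"
  then show "a \<in> frac B"
    unfolding frac_def mem_Collect_eq using csubring_1[OF B]
    by (intro exI[of _ a] exI[of _ 1] conjI) simp_all
qed

lemma csubring_frac: "csubring (frac B)"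
  unfolding csubring_def
proof (intro conjI ballI)
  show "1 \<in> frac B" using frac_incl csubring_1[OF B] by blast
  fix x y assume "x \<in> frac B" "y \<in> frac B"
  then obtain a b c d where x: "x = a / b" "a \<in> B" "b \<in> B" "b \<noteq> 0"
    and y: "y = c / d" "c \<in> B" "d \<in> B" "d \<noteq> 0" by (auto simp: frac_def)
  have "x - y = (a * d - c * b) / (b * d)" "x * y = (a * c) / (b * d)"
    using x y by (simp_all add: field_simps)
  moreover have "a * d - c * b \<in> B" "b * d \<in> B" "a * c \<in> B" "b * d \<noteq> 0"
    using x y B by (auto intro: csubring_closed)
  ultimately show "x - y \<in> frac B" "x * y \<in> frac B" unfolding frac_def by blast+
qed

lemma frac_inverse: "x \<in> frac B \<Longrightarrow> inverse x \<in> frac B"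
proof -
  assume "x \<in> frac B"
  then obtain a b where x: "x = a / b" "a \<in> B" "b \<in> B" "b \<noteq> 0" by (auto simp: frac_def)
  show ?thesis
  proof (cases "a = 0")
    case True
    then show ?thesis using x frac_incl csubring_0[OF B] by auto
  next
    case False
    then have "inverse x = b / a" using x by simp
    with False x show ?thesis unfolding frac_def by blast
  qed
qed

lemma frac_common_denominator:
  "p \<in> coeffs_in (frac B) \<Longrightarrow> \<exists>d\<in>B. d \<noteq> 0 \<and> smult d p \<in> coeffs_in B"
proof (induction p)
  case 0
  then show ?case using coeffs_in_0[OF B] csubring_1[OF B] by (intro bexI[of _ 1]) auto
next
  case (pCons a p)
  have "p \<in> coeffs_in (frac B)" "a \<in> frac B"
    using pCons.prems coeff_coeffs_in[OF pCons.prems, of 0] coeff_coeffs_in[OF pCons.prems, of "Suc _"]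
    by (auto simp: coeffs_in_def)
  with pCons.IH obtain d b c where d: "d \<in> B" "d \<noteq> 0" "smult d p \<in> coeffs_in B"
    and a: "a = b / c" "b \<in> B" "c \<in> B" "c \<noteq> 0" by (auto simp: frac_def)
  have "smult (d * c) (pCons a p) = pCons (d * b) (smult c (smult d p))"
    using a by (simp add: mult.commute)
  also have "\<dots> \<in> coeffs_in B"
    by (rule coeffs_in_pCons[OF B csubring_mult[OF B d(1) a(2)] coeffs_in_smult[OF B a(3) d(3)]])
  finally show ?case 
    using a d csubring_mult[OF B d(1) a(3)] by (intro bexI[of _ "d * c"] conjI) simp_all
qed

lemma transc_frac: "transc (frac B) x \<longleftrightarrow> transc B x"
proof
  show "transc (frac B) x \<Longrightarrow> transc B x" by (rule transc_antimono[OF frac_incl])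
  assume x: "transc B x"
  show "transc (frac B) x"
    unfolding transc_def
  proof (intro ballI impI)
    fix p assume p: "p \<in> coeffs_in (frac B)" "poly p x = 0"
    obtain d where "d \<noteq> 0" "smult d p \<in> coeffs_in B"
      using frac_common_denominator[OF p(1)] by blast
    with transcD[OF x, of "smult d p"] p show "p = 0" by simp
  qed
qed

end

lemma frac_mono: "B \<subseteq> C \<Longrightarrow> frac B \<subseteq> frac C"
  by (auto simp: frac_def)

text \<open>The ring generated over \<open>frac B\<close> lies between the ring generated over
  \<open>B\<close> and the fraction field of the latter, and transcendence over these two outer
  rings is the same by clearing denominators.\<close>

lemma indep_frac:
  assumes B: "csubring B"
  shows "indep (frac B) xs \<longleftrightarrow> indep B xs"
proof (induction xs)
  case (Cons x xs)
  have mid: "ring_gen (frac B \<union> set xs) \<subseteq> frac (ring_gen (B \<union> set xs))"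
    using frac_mono[of B "ring_gen (B \<union> set xs)"] ring_gen_incl[of "B \<union> set xs"]
      frac_incl[OF csubring_ring_gen, of "B \<union> set xs"]
    by (intro ring_gen_minimal csubring_frac csubring_ring_gen) auto
  have "ring_gen (B \<union> set xs) \<subseteq> ring_gen (frac B \<union> set xs)"
    using frac_incl[OF B] by (intro ring_gen_mono) auto
  then have "transc (ring_gen (frac B \<union> set xs)) x \<longleftrightarrow> transc (ring_gen (B \<union> set xs)) x"
    using transc_antimono[OF mid] transc_antimono transc_frac[OF csubring_ring_gen] by blast
  with Cons show ?case by simp
qed simp

text \<open>Bridge between a field record and the type class operations. Applied to
  \<open>ring_of_type_algebra\<close> it makes the theory of algebraic extensions available for
  \<open>acl\<close>; applied to \<open>laurent\<close> it transfers the final results.\<close>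

locale type_field = Ring.field R for R :: "('a::field, 'b) ring_scheme" (structure) +
  assumes carrier_R: "carrier R = UNIV"
    and mult_R: "x \<otimes> y = x * y" and one_R: "\<one> = 1"
    and add_R: "x \<oplus> y = x + y" and zero_R: "\<zero> = 0"
begin

lemma uminus_R: "\<ominus> x = - x"
  by (rule minus_equality) (auto simp: carrier_R add_R zero_R)

lemma inv_R: "x \<noteq> 0 \<Longrightarrow> inv x = inverse x"
  by (rule comm_inv_char) (auto simp: carrier_R mult_R one_R)

lemma nat_pow_R: "x [^] (n::nat) = x ^ n"
  by (induction n) (auto simp: mult_R one_R mult.commute)

lemma subring_iff_csubring: "subring B R \<longleftrightarrow> csubring B"
proof
  assume B: "subring B R"
  show "csubring B"
    using subringE(3,5,6,7)[OF B] unfolding csubring_def one_R uminus_R mult_R add_R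
    by (metis diff_conv_add_uminus)
next
  assume "csubring B"
  then show "subring B R"
    by (intro subringI) (auto simp: carrier_R uminus_R mult_R add_R one_R intro: csubring_closed)
qed

lemma subfield_frac: "csubring B \<Longrightarrow> subfield (frac B) R"
  using frac_inverse[of B] inv_R zero_R csubring_frac[of B] by (intro subfieldI') (auto simp: subring_iff_csubring)

text \<open>Polynomials of the record are lists with the leading coefficient first, hence
  \<open>rev\<close>.\<close>

lemma eval_eq_poly: "eval ps x = poly (Poly (rev ps)) x"
proof (induction ps)
  case (Cons a ps)
  then show ?case by (simp add: add_R mult_R nat_pow_R Poly_snoc poly_monom)
qed (simp add: zero_R)

lemma algebraic_iff_not_transc:
  assumes K: "csubring K"
  shows "algebraic K x \<longleftrightarrow> \<not> transc K x"
proof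
  assume "algebraic K x"
  then have "(algebraic over K) x" by (simp add: over_def)
  then obtain ps where ps: "ps \<in> carrier (K[X])" "ps \<noteq> []" "eval ps x = \<zero>"
    using algebraicE[of K x] K by (auto simp: subring_iff_csubring carrier_R)
  have setps: "set ps \<subseteq> K" "hd ps \<noteq> 0"
    using ps by (auto simp: univ_poly_def polynomial_def zero_R)
  have "poly.coeff (Poly (rev ps)) i \<in> K" for i
    using setps(1) csubring_0[OF K]
    by (auto simp: nth_default_def) (metis length_rev nth_mem set_rev subsetD)
  moreover have "Poly (rev ps) \<noteq> 0"
  proof
    assume "Poly (rev ps) = 0"
    then have "\<forall>a\<in>set ps. a = 0" by (auto simp: Poly_eq_0 dest!: arg_cong[of _ _ set])
    with setps ps(2) show False by auto
  qed
  moreover have "poly (Poly (rev ps)) x = 0" using ps(3) by (simp add: eval_eq_poly zero_R)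
  ultimately show "\<not> transc K x" unfolding transc_def coeffs_in_def by blast
next
  assume "\<not> transc K x"
  then obtain p where p: "p \<in> coeffs_in K" "poly p x = 0" "p \<noteq> 0" by (auto simp: transc_def)
  let ?ps = "rev (coeffs p)"
  have "set (coeffs p) \<subseteq> K" using p(1) by (auto simp: coeffs_def coeffs_in_def)
  moreover have "hd ?ps \<noteq> 0" using p(3) by (simp add: hd_rev last_coeffs_eq_coeff_degree)
  ultimately have "?ps \<in> carrier (K[X])" by (simp add: univ_poly_def polynomial_def zero_R)
  moreover have "?ps \<noteq> []" using p(3) by simp
  moreover have "eval ?ps x = \<zero>" using p(2) by (simp add: eval_eq_poly zero_R)
  ultimately have "(algebraic over K) x" by (rule algebraicI)
  then show "algebraic K x" by (simp add: over_def)
qed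

lemma algebraic_over_frac:
  "csubring B \<Longrightarrow> (algebraic over frac B) x \<longleftrightarrow> \<not> transc B x"
  using algebraic_iff_not_transc[OF csubring_frac] transc_frac by (simp add: over_def)

end

lemma type_field_ring_of_type_algebra: "type_field (ring_of_type_algebra :: 'a::field ring)"
  by (intro type_field.intro field_from_type_algebra type_field_axioms.intro)
    (auto simp: ring_of_type_algebra_def)

lemma poly_eq_sum_atMost:
  fixes p :: "'a::comm_semiring_1 poly"
  assumes "degree p \<le> n"
  shows "poly p x = (\<Sum>i\<le>n. coeff p i * x ^ i)"
  unfolding poly_altdef using assms
  by (intro sum.mono_neutral_left) (auto simp: coeff_eq_0)

definition acl :: "'a::field set \<Rightarrow> 'a set" where
  "acl B = {x. \<not> transc B x}"

lemma acl_mono: "B \<subseteq> C \<Longrightarrow> acl B \<subseteq> acl C"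
  using transc_antimono by (auto simp: acl_def)

context
  fixes B :: "'a::field set"
  assumes B: "csubring B"
begin

lemma acl_incl: "B \<subseteq> acl B"
proof
  fix b assume "b \<in> B"
  then have "[:- b, 1:] \<in> coeffs_in B" "poly [:- b, 1:] b = 0" "[:- b, 1:] \<noteq> 0"
    using B by (auto intro!: coeffs_in_closed intro: csubring_closed)
  then show "b \<in> acl B" unfolding acl_def transc_def by blast
qed

lemma acl_divide:
  assumes x: "x \<in> acl B" and y: "y \<in> acl B"
  shows "x / y \<in> acl B"
proof -
  interpret R: type_field "ring_of_type_algebra :: 'a ring" by (rule type_field_ring_of_type_algebra)
  have "{x \<in> carrier ring_of_type_algebra. (R.algebraic over frac B) x} = acl B"
    by (auto simp: acl_def R.algebraic_over_frac[OF B] R.carrier_R)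
  then have sf: "subfield (acl B) (ring_of_type_algebra :: 'a ring)"
    using R.subfield_of_algebraics[OF R.subfield_frac[OF B]] by simp
  then have *: "csubring (acl B)" using R.subring_iff_csubring subfieldE(1) by blast
  show "x / y \<in> acl B"
  \<comment> \<open>Here \<open>x / 0 = 0\<close>, so a zero denominator does no harm.\<close>
  proof (cases "y = 0")
    case True
    then show ?thesis using csubring_0[OF *] by simp
  next
    case False
    have "inverse y \<in> acl B"
      using R.subfield_m_inv(1)[OF sf, of y] y False by (simp add: R.inv_R R.zero_R)
    then show ?thesis using x csubring_mult[OF *] by (simp add: divide_inverse)
  qed
qed

text \<open>Adjoining \<open>u\<close> and then \<open>a\<close> to \<open>frac B\<close> gives a
  tower of two finite extensions, and every element of a finite extension is algebraic over its
  bottom field.\<close>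

lemma acl_trans:
  assumes u: "u \<in> acl B" and a: "a \<in> acl (ring_gen (insert u B))"
  shows "a \<in> acl B"
proof -
  interpret R: type_field "ring_of_type_algebra :: 'a ring" by (rule type_field_ring_of_type_algebra)
  let ?R = "ring_of_type_algebra :: 'a ring"
  let ?K = "frac B"
  let ?E = "R.simple_extension ?K u"
  have K: "subfield ?K ?R" by (rule R.subfield_frac[OF B])
  have uK: "(R.algebraic over ?K) u" using u by (simp add: acl_def R.algebraic_over_frac[OF B])
  have E: "subfield ?E ?R" using R.simple_extension_is_subfield[OF K] uK R.carrier_R by auto
  have finE: "R.finite_dimension ?K ?E"
    using R.finite_dimension_simple_extension[OF K] uK R.carrier_R by auto
  have "u \<in> ?E" "?K \<subseteq> ?E"
    using R.simple_extension_mem[OF subfieldE(1)[OF K]] R.simple_extension_incl[of ?K u] R.carrier_R by auto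
  then have sub: "ring_gen (insert u B) \<subseteq> ?E"
    using frac_incl[OF B] subfieldE(1)[OF E]
    by (intro ring_gen_minimal) (auto simp: R.subring_iff_csubring)
  have "(R.algebraic over ?E) a"
    using acl_mono[OF sub] a R.algebraic_iff_not_transc[of ?E a] subfieldE(1)[OF E]
    by (auto simp: acl_def over_def R.subring_iff_csubring)
  then have "R.finite_dimension ?E (R.simple_extension ?E a)"
    using R.finite_dimension_simple_extension[OF E] R.carrier_R by auto
  with finE have fin: "R.finite_dimension ?K (R.simple_extension ?E a)"
    by (rule R.telescopic_base_dim(1)[OF K E])
  have "(R.algebraic over ?K) a"
    using R.finite_dimension_imp_algebraic[OF K R.simple_extension_is_subring[OF subfieldE(1)[OF E]] fin]
      R.simple_extension_mem[OF subfieldE(1)[OF E]] R.carrier_R by auto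
  then show ?thesis by (simp add: acl_def R.algebraic_over_frac[OF B])
qed

text \<open>
  A relation for \<open>v\<close> over \<open>B[u]\<close>, read as a polynomial in \<open>u\<close>, is a relation for \<open>u\<close> over \<open>B[v]\<close>;
  it is nontrivial because \<open>v\<close> is transcendental over \<open>B\<close>.
\<close>

lemma acl_exchange:
  assumes v: "v \<notin> acl B" and vu: "v \<in> acl (ring_gen (insert u B))"
  shows "u \<in> acl (ring_gen (insert v B))"
proof -
  obtain p where p: "p \<in> coeffs_in (ring_gen (insert u B))" "poly p v = 0" "p \<noteq> 0"
    using vu by (auto simp: acl_def transc_def)
  have "\<exists>q\<in>coeffs_in B. coeff p i = poly q u \<and> (q = 0 \<longleftrightarrow> coeff p i = 0)" for i
  proof (cases "coeff p i = 0")
    case True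
    then show ?thesis using coeffs_in_0[OF B] by (intro bexI[of _ 0]) auto
  next
    case False
    then show ?thesis using coeff_coeffs_in[OF p(1), of i] ring_gen_insert[OF B, of u] by auto
  qed
  then obtain q where q: "\<And>i. q i \<in> coeffs_in B" "\<And>i. coeff p i = poly (q i) u"
    "\<And>i. q i = 0 \<longleftrightarrow> coeff p i = 0" by metis
  define n where "n = degree p"
  define m where "m = Max ((\<lambda>i. degree (q i)) ` {..n})"
  have m: "degree (q i) \<le> m" if "i \<le> n" for i using that by (auto simp: m_def)
  \<comment> \<open>\<open>coeff (q i) j\<close> is the coefficient of \<open>v ^ i * u ^ j\<close>.
    The relation is given by powers of \<open>v\<close>; \<open>r j\<close> collects the part
    belonging to \<open>u ^ j\<close>, with \<open>m\<close> a common bound for the exponents of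
    \<open>u\<close>.\<close>
  define r where "r j = (\<Sum>i\<le>n. monom (coeff (q i) j) i)" for j
  have r: "r j \<in> coeffs_in B" for j
    unfolding r_def using q(1) by (intro coeffs_in_sum[OF B] coeffs_in_monom[OF B] coeff_coeffs_in)
  have coeff_r: "coeff (r j) i = coeff (q i) j" if "i \<le> n" for i j
    using that by (simp add: r_def coeff_sum coeff_monom)
  have poly_r: "poly (r j) v = (\<Sum>i\<le>n. coeff (q i) j * v ^ i)" for j
    by (simp add: r_def poly_sum poly_monom)
  define P where "P = (\<Sum>j\<le>m. monom (poly (r j) v) j)"
  have "P \<in> coeffs_in (ring_gen (insert v B))"
    unfolding P_def using r ring_gen_insert[OF B, of v]
    by (intro coeffs_in_sum coeffs_in_monom csubring_ring_gen) auto
  moreover have "poly P u = 0"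
  proof -
    have "poly P u = (\<Sum>j\<le>m. \<Sum>i\<le>n. coeff (q i) j * v ^ i * u ^ j)"
      by (simp add: P_def poly_sum poly_monom poly_r sum_distrib_right)
    also have "\<dots> = (\<Sum>i\<le>n. \<Sum>j\<le>m. coeff (q i) j * v ^ i * u ^ j)" by (rule sum.swap)
    also have "\<dots> = (\<Sum>i\<le>n. poly (q i) u * v ^ i)"
      using m by (intro sum.cong) (auto simp: poly_eq_sum_atMost[where n = m] sum_distrib_left sum_distrib_right mult_ac)
    also have "\<dots> = poly p v" by (simp add: poly_altdef n_def q(2))
    finally show ?thesis using p(2) by simp
  qed
  moreover have "P \<noteq> 0"
  proof
    assume P0: "P = 0"
    have "coeff P j = poly (r j) v" if "j \<le> m" for j
      using that by (simp add: P_def coeff_sum coeff_monom)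
    then have r0: "r j = 0" if "j \<le> m" for j
      using transcD[OF _ r, of v j] v P0 that by (simp add: acl_def)
    have "coeff p n \<noteq> 0" using p(3) by (simp add: n_def)
    then have "lead_coeff (q n) \<noteq> 0" using q(3) by simp
    then show False using coeff_r[of n "degree (q n)"] r0[OF m, of n] by simp
  qed
  ultimately show ?thesis unfolding acl_def transc_def by blast
qed

end

lemma indep_length_le:
  assumes "csubring B" "indep B vs" "set vs \<subseteq> acl (ring_gen (B \<union> set us))"
  shows "length vs \<le> length us"
  using assms
proof (induction vs arbitrary: B us rule: rev_induct)
  case (snoc v vs)
  note B = snoc.prems(1)
  let ?B = "ring_gen (insert v B)"
  have v: "v \<notin> acl B" and vs: "indep ?B vs"
    using snoc.prems(2) by (auto simp: indep_snoc[OF B] acl_def)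
  define good where "good ws \<longleftrightarrow> v \<in> acl (ring_gen (B \<union> set ws))" for ws
  \<comment> \<open>Growing the suffix of \<open>us\<close> from the empty list, there is an entry
    \<open>u\<close> at which \<open>v\<close> turns from transcendental to algebraic. Exactly for
    this \<open>u\<close> the exchange property applies.\<close>
  have ind: "good ws \<longrightarrow> (\<exists>us1 u us2. ws = us1 @ u # us2 \<and> \<not> good us2 \<and> good (u # us2))" for ws
  proof (induction ws)
    case Nil
    then show ?case using v by (simp add: good_def ring_gen_id[OF B])
  next
    case (Cons w ws)
    show ?case
    proof (cases "good ws")
      case True
      then show ?thesis using Cons by (metis append_Cons)
    next
      case False
      then show ?thesis by (metis append_Nil)
    qed
  qed
  have "good us" using snoc.prems(3) by (auto simp: good_def)
  then obtain us1 u us2 where us: "us = us1 @ u # us2" and n: "\<not> good us2" and y: "good (u # us2)"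
    using ind by blast
  let ?D = "ring_gen (B \<union> set us2)"
  have "u \<in> acl (ring_gen (insert v ?D))"
    using acl_exchange[OF csubring_ring_gen, of v "B \<union> set us2" u] n y
    by (auto simp: good_def ring_gen_insert_ring_gen)
  moreover have "ring_gen (insert v ?D) \<subseteq> ring_gen (?B \<union> set (us1 @ us2))"
  proof -
    have "ring_gen (insert v ?D) = ring_gen (insert v (B \<union> set us2))" by (rule ring_gen_insert_ring_gen)
    also have "\<dots> \<subseteq> ring_gen (insert v B \<union> set (us1 @ us2))" by (rule ring_gen_mono) auto
    also have "\<dots> = ring_gen (?B \<union> set (us1 @ us2))" by (simp only: ring_gen_Un)
    finally show ?thesis .
  qed
  ultimately have u: "u \<in> acl (ring_gen (?B \<union> set (us1 @ us2)))" using acl_mono by blast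
  have "ring_gen (B \<union> set us) \<subseteq> ring_gen (insert u (ring_gen (?B \<union> set (us1 @ us2))))"
  proof -
    have "ring_gen (B \<union> set us) \<subseteq> ring_gen (insert u (insert v B \<union> set (us1 @ us2)))"
      by (rule ring_gen_mono) (auto simp: us)
    also have "\<dots> = ring_gen (insert u (ring_gen (?B \<union> set (us1 @ us2))))"
      by (simp only: ring_gen_Un ring_gen_insert_ring_gen)
    finally show ?thesis .
  qed
  then have "acl (ring_gen (B \<union> set us)) \<subseteq> acl (ring_gen (?B \<union> set (us1 @ us2)))"
    using acl_mono acl_trans[OF csubring_ring_gen u] by blast
  then have "set vs \<subseteq> acl (ring_gen (?B \<union> set (us1 @ us2)))"
    using snoc.prems(3) by auto
  with snoc.IH[OF csubring_ring_gen vs] have "length vs \<le> length (us1 @ us2)" by blast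
  then show ?case by (simp add: us)
qed simp

text \<open>If no entry of \<open>vs\<close> extended \<open>us\<close>, all of them would be
  algebraic over the ring generated by \<open>us\<close>, against the bound on lengths.\<close>

lemma indep_augment:
  fixes B :: "'a::field set"
  assumes "csubring B" "indep B us" "indep B vs" "length us < length vs"
  shows "\<exists>v\<in>set vs. indep B (v # us)"
  using indep_length_le[OF assms(1,3), of us] assms by (auto simp: acl_def)

section \<open>Prime chains from independent elements\<close>

text \<open>As \<open>u\<close> is neither zero nor a unit modulo \<open>P\<close>, the ideal
  \<open>P + u A\<close> is proper. Zorn's lemma gives a maximal proper ideal above it, which is
  prime.\<close>

lemma exists_larger_prime:
  fixes A P :: "'a::comm_ring_1 set"
  assumes A: "csubring A" and P: "ideal_in A P" and u: "u \<in> A" "u \<notin> P"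
    and nonunit: "\<And>c. c \<in> A \<Longrightarrow> u * c - 1 \<notin> P"
  shows "\<exists>Q. prime_in A Q \<and> P \<subset> Q"
proof -
  have ideal_sum: "ideal_in A {a + v * c | a c. a \<in> I \<and> c \<in> A}" (is "ideal_in A ?S")
    and incl_sum: "insert v I \<subseteq> {a + v * c | a c. a \<in> I \<and> c \<in> A}"
    if I: "ideal_in A I" and v: "v \<in> A" for I v
  proof -
    show "insert v I \<subseteq> ?S"
    proof
      fix x assume "x \<in> insert v I"
      then consider "x = 0 + v * 1" | "x \<in> I" "x = x + v * 0" by auto
      then show "x \<in> ?S" using ideal_in_0[OF I] csubring_0[OF A] csubring_1[OF A] by cases blast+
    qed
    show "ideal_in A ?S"
      unfolding ideal_in_def
    proof (intro conjI ballI subsetI)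
      show "x \<in> A" if "x \<in> ?S" for x
        using that ideal_in_subset[OF I] v A by (auto intro: csubring_closed)
      show "0 \<in> ?S" using ideal_in_0[OF I] csubring_0[OF A] by force
      show "x + y \<in> ?S" if "x \<in> ?S" "y \<in> ?S" for x y
      proof -
        from that obtain a b c d where "x = a + v * c" "y = b + v * d" "a \<in> I" "b \<in> I" "c \<in> A" "d \<in> A"
          by blast
        then have "x + y = (a + b) + v * (c + d)" "a + b \<in> I" "c + d \<in> A"
          by (simp_all add: algebra_simps ideal_in_add[OF I] csubring_add[OF A])
        then show ?thesis by blast
      qed
      show "x * y \<in> ?S" if "x \<in> A" "y \<in> ?S" for x y
      proof -
        from that obtain b d where y: "y = b + v * d" "b \<in> I" "d \<in> A" by blast
        have "x * y = x * b + v * (x * d)" by (simp add: y algebra_simps)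
        moreover have "x * b \<in> I" "x * d \<in> A"
          using that(1) y ideal_in_mult_left[OF I] csubring_mult[OF A] by blast+
        ultimately show ?thesis by blast
      qed
    qed
  qed
  define \<A> where "\<A> = {I. ideal_in A I \<and> insert u P \<subseteq> I \<and> 1 \<notin> I}"
  have "{a + u * c | a c. a \<in> P \<and> c \<in> A} \<in> \<A>"
  proof -
    have "1 \<noteq> a + u * c" if "a \<in> P" "c \<in> A" for a c
    proof
      assume "1 = a + u * c"
      then have "u * c - 1 = - a" by (simp add: algebra_simps)
      then show False using nonunit[OF that(2)] ideal_in_uminus[OF A P that(1)] by simp
    qed
    then show ?thesis using ideal_sum[OF P u(1)] incl_sum[OF P u(1)] unfolding \<A>_def by blast
  qed
  moreover have "\<Union>\<C> \<in> \<A>" if "\<C> \<noteq> {}" "subset.chain \<A> \<C>" for \<C>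
  proof -
    have sub: "\<C> \<subseteq> \<A>" and chain: "\<And>I I'. I \<in> \<C> \<Longrightarrow> I' \<in> \<C> \<Longrightarrow> I \<subseteq> I' \<or> I' \<subseteq> I"
      using that(2) by (auto simp: subset_chain_def)
    have id: "ideal_in A I" if "I \<in> \<C>" for I using that sub by (auto simp: \<A>_def)
    have "a + b \<in> \<Union>\<C>" if "a \<in> \<Union>\<C>" "b \<in> \<Union>\<C>" for a b
    proof -
      from that obtain I I' where I: "I \<in> \<C>" "I' \<in> \<C>" "a \<in> I" "b \<in> I'" by blast
      with chain consider "I \<subseteq> I'" | "I' \<subseteq> I" by blast
      then show ?thesis using I ideal_in_add[OF id] by cases blast+
    qed
    moreover have "a * b \<in> \<Union>\<C>" if "a \<in> A" "b \<in> \<Union>\<C>" for a b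
      using that ideal_in_mult_left[OF id] by blast
    moreover have "\<Union>\<C> \<subseteq> A" using ideal_in_subset[OF id] by blast
    moreover have "0 \<in> \<Union>\<C>" using that(1) ideal_in_0[OF id] by blast
    ultimately have "ideal_in A (\<Union>\<C>)" unfolding ideal_in_def by blast
    then show ?thesis using sub that(1) unfolding \<A>_def by blast
  qed
  ultimately obtain Q where Q: "Q \<in> \<A>" and max: "\<And>I. I \<in> \<A> \<Longrightarrow> Q \<subseteq> I \<Longrightarrow> I = Q"
    using subset_Zorn_nonempty[of \<A>] by blast
  have QI: "ideal_in A Q" and QP: "insert u P \<subseteq> Q" and Q1: "1 \<notin> Q" using Q by (auto simp: \<A>_def)
  \<comment> \<open>Maximality of \<open>Q\<close> makes every element outside it a unit modulo
    \<open>Q\<close>.\<close>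
  have comax: "\<exists>a\<in>Q. \<exists>c\<in>A. 1 = a + v * c" if v: "v \<in> A" "v \<notin> Q" for v
  proof (rule ccontr)
    assume no: "\<not> ?thesis"
    let ?S = "{a + v * c | a c. a \<in> Q \<and> c \<in> A}"
    have "?S \<in> \<A>"
      using ideal_sum[OF QI v(1)] incl_sum[OF QI v(1)] QP no unfolding \<A>_def by blast
    then have "?S = Q" using max incl_sum[OF QI v(1)] by blast
    then show False using incl_sum[OF QI v(1)] v(2) by blast
  qed
  have "v \<in> Q \<or> w \<in> Q" if vw: "v \<in> A" "w \<in> A" "v * w \<in> Q" for v w
  proof (rule ccontr)
    assume "\<not> ?thesis"
    then obtain a c where a: "a \<in> Q" "c \<in> A" "1 = a + v * c" and "w \<notin> Q" using comax vw(1) by blast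
    have "w = w * a + c * (v * w)" using arg_cong[OF a(3), of "\<lambda>z. w * z"] by (simp add: algebra_simps)
    moreover have "w * a + c * (v * w) \<in> Q"
      by (intro ideal_in_add[OF QI] ideal_in_mult_left[OF QI] vw a)
    ultimately show False using \<open>w \<notin> Q\<close> by simp
  qed
  then have "prime_in A Q" using QI Q1 by (auto simp: prime_in_def)
  then show ?thesis using QP u(2) by blast
qed

text \<open>
  Localising at \<open>B[b] - {0}\<close> lowers the transcendence degree by one. The chain obtained there
  contracts to primes of \<open>A\<close> meeting \<open>B[b]\<close> in \<open>0\<close>, and its top is not maximal: otherwise
  \<open>B[b]\<close> would become a field after inverting one element, which is impossible for transcendental \<open>b\<close>.
\<close>

theorem indep_prime_chain:
  fixes B :: "'a::field set"
  assumes B: "csubring B" and bs: "indep B bs" "set bs \<subseteq> ring_gen (B \<union> set gs)"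
  shows "\<exists>P. prime_chain (ring_gen (B \<union> set gs)) (length bs) P"
  using assms
proof (induction bs arbitrary: B rule: rev_induct)
  case Nil
  have "prime_in A {0}" if "csubring A" for A :: "'a set"
    using that by (auto simp: prime_in_def ideal_in_def intro: csubring_0)
  then show ?case
    by (intro exI[of _ "\<lambda>_. {0}"]) (auto simp: prime_chain_def csubring_ring_gen)
next
  case (snoc b bs)
  note B = snoc.prems(1)
  let ?A = "ring_gen (B \<union> set gs)"
  let ?B1 = "ring_gen (insert b B)"
  let ?K = "frac ?B1"
  let ?A' = "ring_gen (?K \<union> set gs)"
  have b: "transc B b" and bs: "indep ?B1 bs" using snoc.prems(2) by (auto simp: indep_snoc[OF B])
  have bA: "b \<in> ?A" using snoc.prems(3) by simp
  have B1A: "?B1 \<subseteq> ?A"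
    using bA ring_gen_incl[of "B \<union> set gs"] by (intro ring_gen_minimal csubring_ring_gen) auto
  have KA': "?K \<subseteq> ?A'" using ring_gen_incl[of "?K \<union> set gs"] by blast
  have BK: "B \<subseteq> ?K" using frac_incl[OF csubring_ring_gen, of "insert b B"] ring_gen_incl[of "insert b B"] by blast
  have AA': "?A \<subseteq> ?A'" using BK by (intro ring_gen_mono) auto
  have "indep ?K bs" using bs by (simp add: indep_frac[OF csubring_ring_gen])
  then obtain P' where P': "prime_chain ?A' (length bs) P'"
    using snoc.IH[OF csubring_frac[OF csubring_ring_gen], of "insert b B"] snoc.prems(3) AA' by auto
  let ?n = "length bs"
  have pr': "prime_in ?A' (P' i)" if "i \<le> ?n" for i using P' that by (simp add: prime_chain_def)
  define P where "P i = P' i \<inter> ?A" for i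
  have pr: "prime_in ?A (P i)" if "i \<le> ?n" for i
    unfolding P_def by (rule prime_in_Int[OF csubring_ring_gen AA' pr'[OF that]])
  \<comment> \<open>The enlarged ring is the localisation of the original one at the nonzero
    elements of \<open>B[b]\<close>.\<close>
  have local: "\<exists>a\<in>?A. \<exists>s\<in>?B1. s \<noteq> 0 \<and> x = a / s" if "x \<in> ?A'" for x
  proof -
    define L where "L = {a / s | a s. a \<in> ?A \<and> s \<in> ?B1 \<and> s \<noteq> 0}"
    have A: "csubring ?A" and B1: "csubring ?B1" by (rule csubring_ring_gen)+
    have "csubring L"
      unfolding csubring_def
    proof (intro conjI ballI)
      have "1 = (1::'a) / 1" by simp
      then show "1 \<in> L" unfolding L_def mem_Collect_eq
        using csubring_1[OF A] csubring_1[OF B1] by (intro exI[of _ 1] conjI) simp_all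
      fix x y assume "x \<in> L" "y \<in> L"
      then obtain a s c t where x: "x = a / s" "a \<in> ?A" "s \<in> ?B1" "s \<noteq> 0"
        and y: "y = c / t" "c \<in> ?A" "t \<in> ?B1" "t \<noteq> 0" by (auto simp: L_def)
      have "x - y = (a * t - c * s) / (s * t)" "x * y = (a * c) / (s * t)"
        using x y by (simp_all add: field_simps)
      moreover have "s * t \<in> ?B1" "s * t \<noteq> 0" using x y csubring_mult[OF B1] by auto
      moreover have "a * t - c * s \<in> ?A" "a * c \<in> ?A"
        using x y A subsetD[OF B1A] by (simp_all add: csubring_closed)
      ultimately show "x - y \<in> L" "x * y \<in> L" unfolding L_def by blast+
    qed
    moreover have "?K \<subseteq> L" unfolding L_def frac_def using B1A by blast
    moreover have "set gs \<subseteq> L"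
    proof
      fix g assume "g \<in> set gs"
      then have "g \<in> ?A" using ring_gen_incl[of "B \<union> set gs"] by blast
      then show "g \<in> L" unfolding L_def mem_Collect_eq
        using csubring_1[OF B1] by (intro exI[of _ g] exI[of _ 1] conjI) simp_all
    qed
    ultimately have "?A' \<subseteq> L" by (intro ring_gen_minimal) auto
    then show ?thesis using that unfolding L_def by blast
  qed
  have K_inv: "inverse s \<in> ?A'" if "s \<in> ?B1" for s
    using frac_inverse[OF csubring_ring_gen] frac_incl[OF csubring_ring_gen, of "insert b B"] KA' that by blast
  \<comment> \<open>A fraction that separates two primes can be replaced by its numerator, since the
    denominator is a unit in the localisation.\<close>
  have strict: "P i \<subset> P (Suc i)" if i: "i < ?n" for i
  proof -
    have sub: "P' i \<subset> P' (Suc i)" using P' i by (simp add: prime_chain_def)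
    then obtain x where x: "x \<in> P' (Suc i)" "x \<notin> P' i" by blast
    note I = prime_in_ideal[OF pr'[of i]] and I' = prime_in_ideal[OF pr'[of "Suc i"]]
    have xA: "x \<in> ?A'" using ideal_in_subset[OF I' x(1)] i by simp
    then obtain a s where a: "a \<in> ?A" "s \<in> ?B1" "s \<noteq> 0" "x = a / s" using local by blast
    have as: "a = x * s" "x = a * inverse s" using a by (simp_all add: field_simps)
    have "s \<in> ?A'" using a(2) B1A AA' by blast
    then have "a \<in> P' (Suc i)" using as(1) ideal_in_mult_right[OF I' x(1)] i by simp
    moreover have "a \<notin> P' i" using as(2) x(2) ideal_in_mult_right[OF I _ K_inv[OF a(2)]] i by auto
    ultimately show ?thesis using sub a(1) unfolding P_def by blast
  qed
  have B1P: "P ?n \<inter> ?B1 = {0}"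
  proof -
    have "s = 0" if s: "s \<in> P' ?n" "s \<in> ?B1" for s
    proof (rule ccontr)
      assume "s \<noteq> 0"
      then have "s * inverse s = 1" by simp
      then show False
        using ideal_in_mult_right[OF prime_in_ideal[OF pr'] s(1) K_inv[OF s(2)]] prime_in_1[OF pr'] by auto
    qed
    moreover have "0 \<in> P ?n" using ideal_in_0[OF prime_in_ideal[OF pr]] by simp
    ultimately show ?thesis using csubring_0[OF csubring_ring_gen, of "insert b B"] unfolding P_def by blast
  qed
  have "\<exists>u\<in>?A - P ?n. \<forall>c\<in>?A. u * c - 1 \<notin> P ?n"
  proof (rule ccontr)
    assume "\<not> ?thesis"
    then have u: "\<exists>c\<in>?A. u * c - 1 \<in> P ?n" if "u \<in> ?A - P ?n" for u using that by blast
    \<comment> \<open>As \<open>b\<close> lies in the ring, \<open>B[b]\<close> may serve as its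
      base, so the descent ends at \<open>B[b]\<close> and not at \<open>B\<close>. It starts with
      \<open>s = 1\<close>, the quotient being a field by the assumption to be refuted.\<close>
    have A: "?A = ring_gen (?B1 \<union> set gs)"
    proof
      show "?A \<subseteq> ring_gen (?B1 \<union> set gs)"
        using ring_gen_incl[of "insert b B"] by (intro ring_gen_mono) auto
      show "ring_gen (?B1 \<union> set gs) \<subseteq> ?A"
        using B1A ring_gen_incl[of "B \<union> set gs"] by (intro ring_gen_minimal csubring_ring_gen) auto
    qed
    have "goldman ?A (P ?n)"
      unfolding goldman_def
    proof (rule bexI[of _ 1], rule ballI)
      show "1 \<in> ?A - P ?n" using prime_in_1[OF pr] csubring_1[OF csubring_ring_gen] by auto
      show "\<exists>c\<in>?A. \<exists>m. v * c - 1 ^ m \<in> P ?n" if "v \<in> ?A - P ?n" for v using u[OF that] by simp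
    qed
    then have "goldman ?B1 (P ?n)"
      using goldman_descent_list[OF csubring_ring_gen, of "insert b B" gs "P ?n"] pr[of ?n] A by simp
    then have "goldman ?B1 {0}" using goldman_Int[OF csubring_ring_gen] B1P by metis
    moreover have "prime_in ?B1 {0}"
      using prime_in_Int[OF csubring_ring_gen B1A pr[of ?n]] B1P by simp
    ultimately show False
      using goldman_imp_algebraic[OF B refl] transcD[OF b] by blast
  qed
  then obtain u where "u \<in> ?A" "u \<notin> P ?n" "\<And>c. c \<in> ?A \<Longrightarrow> u * c - 1 \<notin> P ?n" by blast
  then obtain Q where Q: "prime_in ?A Q" "P ?n \<subset> Q"
    using exists_larger_prime[OF csubring_ring_gen prime_in_ideal[OF pr]] by blast
  have "prime_chain ?A (length (bs @ [b])) (P(Suc ?n := Q))"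
    using pr Q strict by (auto simp: prime_chain_def le_Suc_eq less_Suc_eq)
  then show ?case by blast
qed

section \<open>Algebraic independence of sets\<close>

text \<open>Repeated augmentation. The truncated difference of lengths is 0 when \<open>us\<close>
  is already long enough.\<close>

lemma indep_extend:
  fixes F :: "'a::field set"
  assumes F: "csubring F" and us: "indep F us" and vs: "indep F vs"
  shows "\<exists>ws. set ws \<subseteq> set vs \<and> indep F (ws @ us) \<and> length vs \<le> length ws + length us"
proof -
  have "\<exists>ws. set ws \<subseteq> set vs \<and> indep F (ws @ us) \<and> length ws = k" if "k \<le> length vs - length us" for k
    using that
  proof (induction k)
    case 0
    then show ?case using us by (intro exI[of _ "[]"]) auto
  next
    case (Suc k)
    then obtain ws where ws: "set ws \<subseteq> set vs" "indep F (ws @ us)" "length ws = k" by auto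
    have "length (ws @ us) < length vs" using ws(3) Suc.prems by simp
    then obtain v where "v \<in> set vs" "indep F (v # ws @ us)"
      using indep_augment[OF F ws(2) vs] by blast
    then show ?case using ws by (intro exI[of _ "v # ws"]) auto
  qed
  from this[of "length vs - length us"] show ?thesis by (metis add.commute le_diff_conv order_refl)
qed

text \<open>If a quotient is transcendental, so is its numerator or its denominator, because
  \<open>acl\<close> is closed under division. Augmentation supplies the next quotient to be
  replaced.\<close>

lemma indep_frac_imp_indep:
  fixes F :: "'a::field set"
  assumes F: "csubring F" and vs: "indep F vs" "set vs \<subseteq> frac A"
  shows "\<exists>zs. set zs \<subseteq> A \<and> indep F zs \<and> length zs = length vs"
proof -
  have "\<exists>zs. set zs \<subseteq> A \<and> indep F zs \<and> length zs = k" if "k \<le> length vs" for k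
    using that
  proof (induction k)
    case 0
    show ?case by (intro exI[of _ "[]"]) auto
  next
    case (Suc k)
    then obtain zs where zs: "set zs \<subseteq> A" "indep F zs" "length zs = k" by auto
    let ?B = "ring_gen (F \<union> set zs)"
    obtain v where v: "v \<in> set vs" "indep F (v # zs)" using indep_augment[OF F zs(2) vs(1)] zs Suc.prems by auto
    obtain a b where ab: "v = a / b" "a \<in> A" "b \<in> A" using v(1) vs(2) by (auto simp: frac_def)
    have "v \<notin> acl ?B" using v(2) by (simp add: acl_def)
    then obtain c where "c \<in> {a, b}" "c \<notin> acl ?B" using acl_divide[OF csubring_ring_gen] ab(1) by blast
    then show ?case using zs ab by (intro exI[of _ "c # zs"]) (auto simp: acl_def)
  qed
  then show ?thesis by blast
qed

context type_field
begin

lemma finsum_R: "finite M \<Longrightarrow> (\<Oplus>m\<in>M. f m) = (\<Sum>m\<in>M. f m)"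
  by (induction M rule: finite_induct) (auto simp: carrier_R add_R zero_R)

lemma finprod_R: "finite M \<Longrightarrow> (\<Otimes>m\<in>M. f m) = (\<Prod>m\<in>M. f m)"
  by (induction M rule: finite_induct) (auto simp: carrier_R mult_R one_R)

end

section \<open>Multivariate polynomials as exponent sets with coefficients\<close>

definition monoval :: "'a set \<Rightarrow> ('a \<Rightarrow> nat) set \<Rightarrow> (('a \<Rightarrow> nat) \<Rightarrow> 'a) \<Rightarrow> 'a::comm_ring_1" where
  "monoval B M c = (\<Sum>m\<in>M. c m * (\<Prod>b\<in>B. b ^ m b))"

definition exponents :: "'a set \<Rightarrow> ('a \<Rightarrow> nat) set \<Rightarrow> bool" where
  "exponents B M \<longleftrightarrow> finite M \<and> (\<forall>m\<in>M. \<forall>b. b \<notin> B \<longrightarrow> m b = 0)"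

definition alg_indep_on :: "'a::comm_ring_1 set \<Rightarrow> 'a set \<Rightarrow> bool" where
  "alg_indep_on F B \<longleftrightarrow>
     (\<forall>M c. exponents B M \<longrightarrow> c \<in> M \<rightarrow> F \<longrightarrow> monoval B M c = 0 \<longrightarrow> (\<forall>m\<in>M. c m = 0))"

lemma (in type_field) alg_independent_iff:
  "alg_independent R F B \<longleftrightarrow> finite B \<and> alg_indep_on F B"
proof (cases "finite B")
  case True
  have "(\<Oplus>m\<in>M. c m \<otimes> (\<Otimes>b\<in>B. b [^] m b)) = monoval B M c" if "finite M" for M c
    using that True by (simp add: finsum_R finprod_R mult_R nat_pow_R monoval_def)
  then show ?thesis
    unfolding alg_independent_def alg_indep_on_def exponents_def by (auto simp: carrier_R zero_R True)
qed (simp add: alg_independent_def)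

text \<open>
  A polynomial in \<open>insert b B\<close> is a family of polynomials in \<open>B\<close>, indexed by the exponent of \<open>b\<close>.
\<close>

definition glue :: "'a \<Rightarrow> nat \<Rightarrow> (nat \<Rightarrow> ('a \<Rightarrow> nat) set) \<Rightarrow> ('a \<Rightarrow> nat) set" where
  "glue b n M = (\<lambda>(i, m). m(b := i)) ` (SIGMA i : {..n}. M i)"

text \<open>No exponent in \<open>M i\<close> involves \<open>b\<close>, so a glued exponent
  \<open>m\<close> determines its origin: the index is \<open>m b\<close> and the old exponent is
  \<open>m(b := 0)\<close>. This gives injectivity and explains the form of the coefficient
  function.\<close>

lemma monoval_glue:
  fixes B :: "'a::comm_ring_1 set"
  assumes B: "finite B" "b \<notin> B" and M: "\<And>i. i \<le> n \<Longrightarrow> exponents B (M i)"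
  shows "exponents (insert b B) (glue b n M)"
    and "monoval (insert b B) (glue b n M) (\<lambda>m. c (m b) (m(b := 0))) = (\<Sum>i\<le>n. monoval B (M i) (c i) * b ^ i)"
proof -
  have b0: "m b = 0" if "m \<in> M i" "i \<le> n" for m i using M that B(2) by (auto simp: exponents_def)
  have id: "(m(b := i))(b := 0) = m" if "m \<in> M i" "i \<le> n" for m i using b0[OF that] by auto
  have fin: "finite (M i)" if "i \<le> n" for i using M that by (auto simp: exponents_def)
  show "exponents (insert b B) (glue b n M)"
    using M fin by (auto simp: exponents_def glue_def intro!: finite_imageI finite_SigmaI)
  have inj: "inj_on (\<lambda>(i, m). m(b := i)) (SIGMA i : {..n}. M i)"
  proof (rule inj_onI, clarsimp)
    fix i m j m' assume *: "i \<le> n" "m \<in> M i" "j \<le> n" "m' \<in> M j" and eq: "m(b := i) = m'(b := j)"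
    from fun_cong[OF eq, of b] have "i = j" by simp
    moreover from eq have "(m(b := i))(b := 0) = (m'(b := j))(b := 0)" by simp
    ultimately show "i = j \<and> m = m'" using id * by simp
  qed
  have "monoval (insert b B) (glue b n M) (\<lambda>m. c (m b) (m(b := 0))) =
      (\<Sum>(i, m)\<in>(SIGMA i : {..n}. M i). c i m * (b ^ i * (\<Prod>x\<in>B. x ^ m x)))"
    unfolding monoval_def glue_def sum.reindex[OF inj]
  proof (rule sum.cong[OF refl], clarsimp)
    fix i m assume im: "i \<le> n" "m \<in> M i"
    have "m(b := 0) = m" using b0[OF im(2,1)] by auto
    moreover have "(\<Prod>x\<in>B. x ^ (if x = b then i else m x)) = (\<Prod>x\<in>B. x ^ m x)"
      using B by (intro prod.cong) auto
    ultimately show "c i (m(b := 0)) * (\<Prod>x\<in>insert b B. x ^ (if x = b then i else m x)) = c i m * (b ^ i * (\<Prod>x\<in>B. x ^ m x))"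
      using B by simp
  qed
  also have "\<dots> = (\<Sum>i\<le>n. \<Sum>m\<in>M i. c i m * (b ^ i * (\<Prod>x\<in>B. x ^ m x)))"
    using fin by (subst sum.Sigma) auto
  also have "\<dots> = (\<Sum>i\<le>n. monoval B (M i) (c i) * b ^ i)"
    by (simp add: monoval_def sum_distrib_left sum_distrib_right mult_ac)
  finally show "monoval (insert b B) (glue b n M) (\<lambda>m. c (m b) (m(b := 0))) =
    (\<Sum>i\<le>n. monoval B (M i) (c i) * b ^ i)" .
qed

text \<open>The converse direction: slicing \<open>M\<close> by the exponent of \<open>b\<close>
  recovers a family that glues to \<open>M\<close>.\<close>

lemma glue_split:
  assumes "exponents (insert b B) M" "\<And>m. m \<in> M \<Longrightarrow> m b \<le> n"
  shows "glue b n (\<lambda>i. (\<lambda>m. m(b := 0)) ` {m \<in> M. m b = i}) = M" (is "?G = M")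
    and "exponents B ((\<lambda>m. m(b := 0)) ` {m \<in> M. m b = i})"
proof -
  show "?G = M"
  proof
    show "?G \<subseteq> M" by (auto simp: glue_def)
    show "M \<subseteq> ?G"
    proof
      fix m assume m: "m \<in> M"
      then have "(m b, m(b := 0)) \<in> (SIGMA i : {..n}. (\<lambda>m. m(b := 0)) ` {m \<in> M. m b = i})"
        using assms(2) by auto
      then show "m \<in> ?G" unfolding glue_def by (rule rev_image_eqI) simp
    qed
  qed
  show "exponents B ((\<lambda>m. m(b := 0)) ` {m \<in> M. m b = i})" using assms(1) by (auto simp: exponents_def)
qed

lemma monoval_in:
  assumes F: "csubring F" and c: "c \<in> M \<rightarrow> F"
  shows "monoval B M c \<in> ring_gen (F \<union> B)"
  using c ring_gen_incl[of "F \<union> B"] unfolding monoval_def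
  by (intro csubring_sum csubring_mult csubring_prod csubring_power csubring_ring_gen) auto

lemma glue_coeff:
  assumes "\<And>i. i \<le> n \<Longrightarrow> c i \<in> M i \<rightarrow> F" "b \<notin> B" "\<And>i. i \<le> n \<Longrightarrow> exponents B (M i)"
  shows "(\<lambda>m. c (m b) (m(b := 0))) \<in> glue b n M \<rightarrow> F"
proof
  fix m assume "m \<in> glue b n M"
  then obtain i m' where m: "i \<le> n" "m' \<in> M i" "m = m'(b := i)" by (auto simp: glue_def)
  moreover have "m'(b := 0) = m'" using assms(2,3) m by (auto simp: exponents_def)
  ultimately show "c (m b) (m(b := 0)) \<in> F" using assms(1)[OF m(1)] by auto
qed

lemma ring_gen_eq_monoval:
  fixes F :: "'a::comm_ring_1 set"
  assumes F: "csubring F" and B: "finite B" and a: "a \<in> ring_gen (F \<union> B)"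
  shows "\<exists>M c. exponents B M \<and> c \<in> M \<rightarrow> F \<and> a = monoval B M c"
  using B a
proof (induction B arbitrary: a rule: finite_induct)
  case empty
  then show ?case
    \<comment> \<open>A constant polynomial: its only exponent is the zero function.\<close>
    by (intro exI[of _ "{\<lambda>_. 0}"] exI[of _ "\<lambda>_. a"]) (auto simp: exponents_def monoval_def ring_gen_id[OF F])
next
  case (insert b B)
  have "a \<in> ring_gen (insert b (ring_gen (F \<union> B)))" using insert.prems by (simp add: ring_gen_insert_ring_gen)
  then obtain p where p: "p \<in> coeffs_in (ring_gen (F \<union> B))" "a = poly p b"
    using ring_gen_insert[OF csubring_ring_gen] by blast
  have "\<forall>i. \<exists>M c. exponents B M \<and> c \<in> M \<rightarrow> F \<and> coeff p i = monoval B M c"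
    using insert.IH[OF coeff_coeffs_in[OF p(1)]] by blast
  then obtain M c where M: "\<And>i. exponents B (M i)" "\<And>i. c i \<in> M i \<rightarrow> F" "\<And>i. coeff p i = monoval B (M i) (c i)"
    by metis
  let ?n = "degree p"
  have "a = monoval (insert b B) (glue b ?n M) (\<lambda>m. c (m b) (m(b := 0)))"
    using monoval_glue(2)[OF insert.hyps(1,2) M(1), where n = ?n and c = c] p(2) by (simp add: poly_altdef M(3))
  moreover have "exponents (insert b B) (glue b ?n M)"
    by (rule monoval_glue(1)[OF insert.hyps(1,2) M(1)])
  moreover have "(\<lambda>m. c (m b) (m(b := 0))) \<in> glue b ?n M \<rightarrow> F"
    by (rule glue_coeff[OF M(2) insert.hyps(2) M(1)])
  ultimately show ?case by blast
qed

text \<open>Links the definition by multivariate relations with the one-element-at-a-time form of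
  \<open>indep\<close>. Gluing turns a relation for \<open>b\<close> over the generated ring into a
  multivariate relation, slicing goes back.\<close>

lemma alg_indep_on_insert:
  fixes F :: "'a::comm_ring_1 set"
  assumes F: "csubring F" and B: "finite B" "b \<notin> B"
  shows "alg_indep_on F (insert b B) \<longleftrightarrow> alg_indep_on F B \<and> transc (ring_gen (F \<union> B)) b"
proof (intro iffI conjI)
  assume AI: "alg_indep_on F (insert b B)"
  show "alg_indep_on F B"
    unfolding alg_indep_on_def
  proof (intro allI impI)
    fix M c assume M: "exponents B M" "c \<in> M \<rightarrow> F" "monoval B M c = 0"
    have "monoval (insert b B) M c = monoval B M c"
      unfolding monoval_def
    proof (intro sum.cong refl)
      fix m assume "m \<in> M"
      then have "m b = 0" using M(1) B by (auto simp: exponents_def)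
      then show "c m * (\<Prod>x\<in>insert b B. x ^ m x) = c m * (\<Prod>x\<in>B. x ^ m x)" using B by simp
    qed
    moreover have "exponents (insert b B) M" using M(1) by (auto simp: exponents_def)
    ultimately show "\<forall>m\<in>M. c m = 0" using AI M unfolding alg_indep_on_def by metis
  qed
  show "transc (ring_gen (F \<union> B)) b"
    unfolding transc_def
  proof (intro ballI impI)
    fix p assume p: "p \<in> coeffs_in (ring_gen (F \<union> B))" "poly p b = 0"
    have "\<forall>i. \<exists>M c. exponents B M \<and> c \<in> M \<rightarrow> F \<and> coeff p i = monoval B M c"
      using ring_gen_eq_monoval[OF F B(1) coeff_coeffs_in[OF p(1)]] by blast
    then obtain M c where M: "\<And>i. exponents B (M i)" "\<And>i. c i \<in> M i \<rightarrow> F"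
      "\<And>i. coeff p i = monoval B (M i) (c i)" by metis
    let ?G = "glue b (degree p) M" and ?c = "\<lambda>m. c (m b) (m(b := 0))"
    have "monoval (insert b B) ?G ?c = 0"
      using monoval_glue(2)[OF B M(1), where n = "degree p" and c = c] p(2) by (simp add: poly_altdef M(3))
    moreover have "exponents (insert b B) ?G" by (rule monoval_glue(1)[OF B M(1)])
    moreover have "?c \<in> ?G \<rightarrow> F" by (rule glue_coeff[OF M(2) B(2) M(1)])
    ultimately have c0: "?c m = 0" if "m \<in> ?G" for m using AI that unfolding alg_indep_on_def by blast
    have "c i m = 0" if i: "i \<le> degree p" "m \<in> M i" for i m
    proof -
      have "m(b := i) \<in> ?G" unfolding glue_def using i by (intro rev_image_eqI[of "(i, m)"]) auto
      moreover have "m(b := 0) = m" using M(1)[of i] i B(2) by (auto simp: exponents_def)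
      ultimately show ?thesis using c0[of "m(b := i)"] by simp
    qed
    then have "coeff p i = 0" if "i \<le> degree p" for i using that by (simp add: M(3) monoval_def)
    then show "p = 0" by (metis leading_coeff_0_iff order_refl)
  qed
next
  assume AI: "alg_indep_on F B \<and> transc (ring_gen (F \<union> B)) b"
  show "alg_indep_on F (insert b B)"
    unfolding alg_indep_on_def
  proof (intro allI impI ballI)
    fix M c m assume M: "exponents (insert b B) M" "c \<in> M \<rightarrow> F" "monoval (insert b B) M c = 0" and m: "m \<in> M"
    define n where "n = Max ((\<lambda>m. m b) ` M)"
    have n: "m b \<le> n" if "m \<in> M" for m using that M(1) by (auto simp: n_def exponents_def)
    define N where "N i = (\<lambda>m. m(b := 0)) ` {m \<in> M. m b = i}" for i
    \<comment> \<open>Chosen to invert the reindexing of \<open>glue\<close>: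
      \<open>d (m b) (m(b := 0))\<close> is again \<open>c m\<close>.\<close>
    define d where "d i m = c (m(b := i))" for i m
    have glue: "glue b n N = M" unfolding N_def by (rule glue_split(1)[OF M(1), of n]) (rule n)
    have N: "exponents B (N i)" for i unfolding N_def by (rule glue_split(2)[OF M(1), of n]) (rule n)
    have d: "d i \<in> N i \<rightarrow> F" for i using M(2) by (auto simp: d_def N_def)
    define p where "p = (\<Sum>i\<le>n. Polynomial.monom (monoval B (N i) (d i)) i)"
    have coeff_p: "coeff p i = monoval B (N i) (d i)" if "i \<le> n" for i
      using that by (simp add: p_def coeff_sum coeff_monom)
    have "(\<lambda>m. d (m b) (m(b := 0))) = c" by (simp add: d_def)
    then have "(\<Sum>i\<le>n. monoval B (N i) (d i) * b ^ i) = 0"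
      using monoval_glue(2)[where n = n and M = N and c = d, OF B N] M(3) by (simp add: glue)
    then have "poly p b = 0" by (simp add: p_def poly_sum poly_monom)
    moreover have "p \<in> coeffs_in (ring_gen (F \<union> B))"
      unfolding p_def using monoval_in[OF F d] by (intro coeffs_in_sum coeffs_in_monom csubring_ring_gen)
    ultimately have "p = 0" using AI transcD by blast
    then have "monoval B (N (m b)) (d (m b)) = 0" using coeff_p[OF n[OF m]] by simp
    moreover have "m(b := 0) \<in> N (m b)" using m by (auto simp: N_def)
    ultimately have "d (m b) (m(b := 0)) = 0" using AI N d unfolding alg_indep_on_def by blast
    then show "c m = 0" by (simp add: d_def)
  qed
qed

text \<open>Distinctness is automatic for independent lists, since a repeated entry already lies in
  the ring generated by the later ones; a set, however, cannot see repetitions.\<close>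

lemma indep_iff_alg_indep_on:
  fixes F :: "'a::field set"
  assumes F: "csubring F"
  shows "indep F xs \<longleftrightarrow> distinct xs \<and> alg_indep_on F (set xs)"
proof (induction xs)
  case Nil
  have "c m = 0" if "exponents {} M" "monoval {} M c = 0" "m \<in> M" for M and m :: "'a \<Rightarrow> nat" and c :: "('a \<Rightarrow> nat) \<Rightarrow> 'a"
  proof -
    have "m' = m" if "m' \<in> M" for m'
      using that \<open>exponents {} M\<close> \<open>m \<in> M\<close> unfolding exponents_def by (intro ext) (metis empty_iff)
    then have "M = {m}" using that(3) by blast
    then show ?thesis using that(2) by (simp add: monoval_def)
  qed
  then show ?case by (auto simp: alg_indep_on_def)
next
  case (Cons x xs)
  show ?case
  proof (cases "x \<in> set xs")
    case True
    then have "x \<in> acl (ring_gen (F \<union> set xs))"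
      using acl_incl[OF csubring_ring_gen] ring_gen_incl[of "F \<union> set xs"] by blast
    with True show ?thesis by (auto simp: acl_def)
  next
    case False
    then show ?thesis using Cons alg_indep_on_insert[OF F, of "set xs" x] by auto
  qed
qed

section \<open>Krull dimension and transcendence degree\<close>

text \<open>The common yardstick: its supremum is the transcendence degree when \<open>A\<close> is
  a field and the Krull dimension when \<open>A\<close> is a finitely generated algebra over a field
  \<open>F\<close>.\<close>

definition rank_set :: "'a::field set \<Rightarrow> 'a set \<Rightarrow> enat set" where
  "rank_set F A = {enat (length xs) | xs. set xs \<subseteq> A \<and> indep F xs}"

lemma rank_set_nonempty: "rank_set F A \<noteq> {}"
  unfolding rank_set_def by (auto intro!: exI[of _ "[]"])

lemma Sup_rank_set_self:
  assumes "csubring F"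
  shows "Sup (rank_set F F) = 0"
proof -
  have "xs = []" if "set xs \<subseteq> F" "indep F xs" for xs
  proof (cases xs)
    case (Cons x zs)
    then have "x \<in> acl (ring_gen (F \<union> set zs))"
      using that acl_incl[OF csubring_ring_gen] ring_gen_incl[of "F \<union> set zs"] by auto
    with Cons that show ?thesis by (simp add: acl_def)
  qed simp
  then have "rank_set F F = {0}" using rank_set_nonempty[of F F] by (auto simp: rank_set_def zero_enat_def)
  then show ?thesis by simp
qed

text \<open>The empty set has to be excluded because its supremum is 0, which would lose the summand
  \<open>k\<close>.\<close>

lemma enat_add_Sup:
  assumes "Z \<noteq> {}"
  shows "enat k + Sup Z = Sup ((+) (enat k) ` Z)"
proof (induction k)
  case 0
  then show ?case by (simp flip: zero_enat_def)
next
  case (Suc k)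
  have "enat (Suc k) + x = eSuc (enat k + x)" for x by (simp add: iadd_Suc flip: eSuc_enat)
  then show ?case using eSuc_Sup[of "(+) (enat k) ` Z"] assms Suc by (simp add: image_image)
qed

text \<open>Additivity without finiteness. For one inequality an independent list in
  \<open>A\<close> is used to extend \<open>us\<close>; for the other, \<open>us\<close> is joined
  to a list in \<open>frac A\<close> and the fractions are traded for elements of
  \<open>A\<close>.\<close>

lemma Sup_rank_set_add:
  fixes F A :: "'a::field set"
  assumes F: "csubring F" and A: "csubring A" and us: "indep F us" "set us \<subseteq> A"
  shows "Sup (rank_set F A) = enat (length us) + Sup (rank_set (frac (ring_gen (F \<union> set us))) (frac A))"
    (is "?L = _ + Sup ?Z")
proof (rule antisym)
  let ?B = "ring_gen (F \<union> set us)"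
  have fracB: "indep (frac ?B) ws \<longleftrightarrow> indep F (ws @ us)" for ws
    using us by (simp add: indep_append indep_frac[OF csubring_ring_gen])
  show "?L \<le> enat (length us) + Sup ?Z"
  proof (rule Sup_least)
    fix n assume "n \<in> rank_set F A"
    then obtain vs where vs: "n = enat (length vs)" "set vs \<subseteq> A" "indep F vs" by (auto simp: rank_set_def)
    obtain ws where ws: "set ws \<subseteq> set vs" "indep F (ws @ us)" "length vs \<le> length ws + length us"
      using indep_extend[OF F us(1) vs(3)] by blast
    have "set ws \<subseteq> frac A" using ws(1) vs(2) frac_incl[OF A] by blast
    then have "enat (length ws) \<in> ?Z" using ws(2) fracB by (auto simp: rank_set_def)
    then have "enat (length us) + enat (length ws) \<le> enat (length us) + Sup ?Z"
      by (intro add_left_mono Sup_upper)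
    moreover have "n \<le> enat (length us) + enat (length ws)" using vs(1) ws(3) by simp
    ultimately show "n \<le> enat (length us) + Sup ?Z" by simp
  qed
  show "enat (length us) + Sup ?Z \<le> ?L"
    unfolding enat_add_Sup[OF rank_set_nonempty]
  proof (rule Sup_least)
    fix n assume "n \<in> (+) (enat (length us)) ` ?Z"
    then obtain ws where ws: "n = enat (length us) + enat (length ws)" "set ws \<subseteq> frac A" "indep F (ws @ us)"
      by (auto simp: rank_set_def fracB)
    have "set (ws @ us) \<subseteq> frac A" using ws(2) us(2) frac_incl[OF A] by auto
    then obtain zs where "set zs \<subseteq> A" "indep F zs" "length zs = length (ws @ us)"
      using indep_frac_imp_indep[OF F ws(3)] by blast
    then have "enat (length (ws @ us)) \<in> rank_set F A"
      unfolding rank_set_def by (metis (mono_tags, lifting) mem_Collect_eq)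
    then show "n \<le> ?L" using Sup_upper[of _ "rank_set F A"] ws(1) by (simp add: add.commute)
  qed
qed

text \<open>Primes are pulled back along \<open>h\<close>; surjectivity keeps the inclusions
  strict.\<close>

lemma krull_dim_surj:
  assumes S: "cring S" and S': "ring S'" and h: "h \<in> Ring.ring_hom S S'" "h ` carrier S = carrier S'"
  shows "krull_dim S' \<le> krull_dim S"
  unfolding krull_dim_def
proof (intro Sup_subset_mono, clarify)
  interpret ring_hom_ring S S' h
    using S S' h(1) by (intro ring_hom_ringI2) (auto simp: cring_def)
  fix n and P :: "nat \<Rightarrow> 'c set"
  assume P: "\<forall>i\<le>n. primeideal (P i) S'" and strict: "\<forall>i<n. P i \<subset> P (Suc i)"
  have "{r \<in> carrier S. h r \<in> P i} \<subset> {r \<in> carrier S. h r \<in> P (Suc i)}" if i: "i < n" for i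
  proof -
    obtain x where x: "x \<in> P (Suc i)" "x \<notin> P i" using strict i by blast
    interpret primeideal "P (Suc i)" S' using P i by simp
    obtain r where "r \<in> carrier S" "x = h r" using x(1) a_subset h(2) by blast
    then show ?thesis using x strict i by blast
  qed
  then show "\<exists>m. enat n = enat m \<and> (\<exists>P. (\<forall>i\<le>m. primeideal (P i) S) \<and> (\<forall>i<m. P i \<subset> P (Suc i)))"
    using P primeideal_vimage[OF S]
    by (intro exI[of _ n] conjI exI[of _ "\<lambda>i. {r \<in> carrier S. h r \<in> P i}"]) auto
qed

context type_field
begin

lemma trdeg_eq_Sup_rank_set:
  assumes "csubring F"
  shows "trdeg R F L = Sup (rank_set F L)"
proof -
  have "{enat (card B) | B. B \<subseteq> L \<and> alg_independent R F B} = rank_set F L"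
    unfolding rank_set_def alg_independent_iff indep_iff_alg_indep_on[OF assms]
    by (auto simp: distinct_card) (metis distinct_card finite_distinct_list, metis List.finite_set distinct_card)
  then show ?thesis by (simp add: trdeg_def)
qed

lemma cring_subring: "csubring A \<Longrightarrow> cring (R\<lparr>carrier := A\<rparr>)"
  using subcring_iff[of A] subcringI'[of A] by (auto simp: carrier_R subring_iff_csubring)

lemma primeideal_iff_prime_in:
  assumes A: "csubring A"
  shows "primeideal P (R\<lparr>carrier := A\<rparr>) \<longleftrightarrow> prime_in A P"
proof
  assume "primeideal P (R\<lparr>carrier := A\<rparr>)"
  then interpret I: primeideal P "R\<lparr>carrier := A\<rparr>" .
  have "1 \<notin> P"
  proof
    assume "1 \<in> P"
    then have "A \<subseteq> P" using I.I_l_closed[of 1] by (auto simp: mult_R)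
    then show False using I.I_notcarr I.a_subset by auto
  qed
  then show "prime_in A P"
    using I.a_subset additive_subgroup.zero_closed[OF I.is_additive_subgroup]
      additive_subgroup.a_closed[OF I.is_additive_subgroup] I.I_l_closed I.I_prime
    by (auto simp: prime_in_def ideal_in_def mult_R add_R zero_R)
next
  assume P: "prime_in A P"
  note I = prime_in_ideal[OF P]
  interpret A: cring "R\<lparr>carrier := A\<rparr>" by (rule cring_subring[OF A])
  have minus: "\<ominus>\<^bsub>R\<lparr>carrier := A\<rparr>\<^esub> x = - x" if "x \<in> A" for x
    using that csubring_uminus[OF A] by (intro A.minus_equality) (auto simp: add_R zero_R)
  show "primeideal P (R\<lparr>carrier := A\<rparr>)"
  proof (rule primeidealI[OF idealI])
    show "subgroup P (add_monoid (R\<lparr>carrier := A\<rparr>))"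
    proof (rule A.add.subgroupI)
      show "\<ominus>\<^bsub>R\<lparr>carrier := A\<rparr>\<^esub> a \<in> P" if "a \<in> P" for a
        using minus[OF ideal_in_subset[OF I that]] ideal_in_uminus[OF A I that] by simp
    qed (use I in \<open>auto simp: add_R ideal_in_def\<close>)
    show "carrier (R\<lparr>carrier := A\<rparr>) \<noteq> P" using prime_in_1[OF P] csubring_1[OF A] by auto
  qed (use P I in \<open>auto simp: mult_R prime_in_mult ideal_in_mult_left ideal_in_mult_right
      intro: A.ring_axioms A.cring_axioms\<close>)
qed

text \<open>Nonzero elements of the field \<open>F\<close> are units, so every prime meets
  \<open>F\<close> only in 0 and chains yield independent lists. Finite generation enters for the
  converse, through \<open>indep_prime_chain\<close>.\<close>

lemma krull_dim_eq_Sup_rank_set: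
  assumes F: "csubring F" "\<And>c. c \<in> F \<Longrightarrow> inverse c \<in> F"
    and A: "A = ring_gen (F \<union> G)" and G: "finite G"
  shows "krull_dim (R\<lparr>carrier := A\<rparr>) = Sup (rank_set F A)"
proof -
  have csub: "csubring A" unfolding A by (rule csubring_ring_gen)
  have FA: "F \<subseteq> A" using ring_gen_incl[of "F \<union> G"] A by blast
  obtain gs where gs: "set gs = G" using finite_list[OF G] by blast
  have F0: "F \<inter> P \<subseteq> {0}" if P: "prime_in A P" for P
  proof
    fix c assume c: "c \<in> F \<inter> P"
    have "c * inverse c \<in> P" using c F(2) FA ideal_in_mult_right[OF prime_in_ideal[OF P]] by blast
    then show "c \<in> {0}" using prime_in_1[OF P] by (cases "c = 0") auto
  qed
  have "(\<exists>P. prime_chain A n P) \<longleftrightarrow> (\<exists>xs. set xs \<subseteq> A \<and> length xs = n \<and> indep F xs)" for n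
    using prime_chain_indep[OF csub F(1) FA, of n] F0 indep_prime_chain[OF F(1), of _ gs]
    unfolding A gs prime_chain_def by blast
  then have "{enat n | n. \<exists>P. prime_chain A n P} = rank_set F A" by (auto simp: rank_set_def)
  then show ?thesis
    by (simp add: krull_dim_def prime_chain_def primeideal_iff_prime_in[OF csub])
qed

lemma generate_ring_eq_ring_gen: "generate_ring R H = ring_gen H"
proof
  show "generate_ring R H \<subseteq> ring_gen H"
    using generate_ring_min_subring1[of H "ring_gen H"] csubring_ring_gen ring_gen_incl
    by (auto simp: carrier_R subring_iff_csubring)
  show "ring_gen H \<subseteq> generate_ring R H"
    using generate_ring_is_subring[of H]
    by (intro ring_gen_minimal) (auto simp: carrier_R subring_iff_csubring intro: generate_ring.incl)
qed

lemma generate_field_eq_frac: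
  assumes A: "csubring A"
  shows "generate_field R A = frac A"
proof
  show "generate_field R A \<subseteq> frac A"
    using generate_field_min_subfield1[of A "frac A"] subfield_frac[OF A] frac_incl[OF A]
    by (auto simp: carrier_R)
  have K: "subfield (generate_field R A) R" by (rule generate_field_is_subfield) (simp add: carrier_R)
  show "frac A \<subseteq> generate_field R A"
  proof
    fix x assume "x \<in> frac A"
    then obtain a b where x: "x = a / b" "a \<in> A" "b \<in> A" "b \<noteq> 0" by (auto simp: frac_def)
    then have "a \<in> generate_field R A" "b \<in> generate_field R A - {\<zero>}"
      by (auto simp: zero_R intro: generate_field.incl)
    then have "a \<otimes> inv b \<in> generate_field R A"
      using subfield_m_inv(1)[OF K] subringE(6)[OF subfieldE(1)[OF K]] by blast
    then show "x \<in> generate_field R A" using x by (simp add: mult_R inv_R divide_inverse)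
  qed
qed

text \<open>Carries finite generation from \<open>S j\<close> over to its image.\<close>

lemma image_generate_ring:
  assumes S: "ring S" and h: "h \<in> Ring.ring_hom S R" and H: "H \<subseteq> carrier S"
  shows "h ` generate_ring S H = ring_gen (h ` H)"
proof -
  interpret h: ring_hom_ring S R h
    using S h ring_axioms by (intro ring_hom_ringI2)
  note gen = h.R.generate_ring_in_carrier[OF H]
  show ?thesis
  proof
    show "h ` generate_ring S H \<subseteq> ring_gen (h ` H)"
    proof clarify
      fix x assume "x \<in> generate_ring S H"
      then show "h x \<in> ring_gen (h ` H)"
      proof (induction rule: generate_ring.induct)
        case (incl x)
        then show ?case using ring_gen_incl[of "h ` H"] by blast
      qed (simp_all add: gen one_R uminus_R add_R mult_R csubring_ring_gen csubring_closed)
    qed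
    have "csubring (h ` generate_ring S H)"
      unfolding csubring_def
    proof (intro conjI ballI)
      show "1 \<in> h ` generate_ring S H" using generate_ring.one[of S H] h.hom_one one_R by (metis image_eqI)
      fix a b assume "a \<in> h ` generate_ring S H" "b \<in> h ` generate_ring S H"
      then obtain x y where xy: "x \<in> generate_ring S H" "y \<in> generate_ring S H" "a = h x" "b = h y" by blast
      have "a - b = h (x \<oplus>\<^bsub>S\<^esub> \<ominus>\<^bsub>S\<^esub> y)" "a * b = h (x \<otimes>\<^bsub>S\<^esub> y)"
        using xy gen by (simp_all add: add_R mult_R uminus_R)
      moreover have "x \<oplus>\<^bsub>S\<^esub> \<ominus>\<^bsub>S\<^esub> y \<in> generate_ring S H" "x \<otimes>\<^bsub>S\<^esub> y \<in> generate_ring S H"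
        using xy by (auto intro: generate_ring.eng_add generate_ring.a_inv generate_ring.eng_mult)
      ultimately show "a - b \<in> h ` generate_ring S H" "a * b \<in> h ` generate_ring S H" by blast+
    qed
    then show "ring_gen (h ` H) \<subseteq> h ` generate_ring S H"
      by (intro ring_gen_minimal) (auto intro: generate_ring.incl)
  qed
qed

end

section \<open>The valuation ring\<close>

lemma type_field_laurent: "type_field (laurent :: ('p::prime_card mod_ring, _) module)"
  by (intro type_field.intro field_laurent type_field_axioms.intro) (auto simp: laurent_def)

text \<open>With constant coefficients, the coefficient of \<open>t ^ j\<close> in the value at
  \<open>t\<close> is the coefficient of degree \<open>j\<close> of the polynomial itself.\<close>

lemma transc_fls_X:
  assumes "F \<subseteq> range fls_const"
  shows "transc F (fls_X :: 'a::field fls)"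
  unfolding transc_def
proof (intro ballI impI)
  fix p :: "'a fls poly" assume p: "p \<in> coeffs_in F" "poly p fls_X = 0"
  have c: "\<exists>c. coeff p i = fls_const c" for i using coeff_coeffs_in[OF p(1), of i] assms by blast
  then obtain c where c: "\<And>i. coeff p i = fls_const (c i)" by metis
  have "c j = 0" if "j \<le> degree p" for j
  proof -
    have "fls_nth (poly p fls_X) (int j) = (\<Sum>i\<le>degree p. fls_nth (coeff p i * fls_X ^ i) (int j))"
      by (simp add: poly_altdef fls_nth_sum)
    also have "\<dots> = (\<Sum>i\<le>degree p. if i = j then c i else 0)"
      by (intro sum.cong) (auto simp: c)
    also have "\<dots> = c j" using that by simp
    finally show ?thesis using p(2) by simp
  qed
  then have "lead_coeff p = 0" by (simp add: c)
  then show "p = 0" by simp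
qed

theorem mainTheorem4:
  fixes y :: "'p::prime_card mod_ring alg_closure fps"
    and J :: "('o, 'm) cat"
    and S :: "'o \<Rightarrow> ('p mod_ring, 's) module"
    and T :: "'o \<Rightarrow> 'o \<Rightarrow> 'm \<Rightarrow> 's \<Rightarrow> 's"
    and \<phi> :: "'o \<Rightarrow> 's \<Rightarrow> 'p mod_ring alg_closure fls"
  assumes nonunit: "\<not> y dvd 1"
    and transcendental: "\<not> ring.algebraic laurent field_kt (fps_to_fls y)"
    and smooth: "\<And>j. j \<in> Ob J \<Longrightarrow> smooth_algebra prime_field (S j)"
    and colimit: "is_filtered_colimit J prime_field S T (sub_laurent (valuation_ring y)) \<phi>"
  defines "A \<equiv> \<lambda>j. \<phi> j ` carrier (S j)"
  shows "\<exists>j\<^sub>0\<in>Ob J. \<forall>j\<in>Ob J. Hom J j\<^sub>0 j \<noteq> {} \<longrightarrow>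
     fls_X \<in> A j \<and> fps_to_fls y \<in> A j \<and> ring_Fpxy y \<subseteq> A j \<and>
     krull_dim (sub_laurent (A j)) =
       krull_dim (sub_laurent (ring_Fpxy y)) +
       trdeg laurent (fraction_field (ring_Fpxy y)) (fraction_field (A j)) \<and>
     krull_dim (sub_laurent (A j)) \<ge> 2 \<and>
     krull_dim (S j) \<ge> 2"
proof -
  interpret L: type_field "laurent :: ('p mod_ring, 'p mod_ring alg_closure fls) module"
    by (rule type_field_laurent)
  define F :: "'p mod_ring alg_closure fls set" where "F = range (fls_const \<circ> to_ac)"
  \<comment> \<open>The order matters: the head \<open>y\<close> is tested over the ring generated
    by \<open>x\<close>, which is where the transcendence hypothesis applies.\<close>
  define us where "us = [fps_to_fls y, fls_X]"
  define B where "B = ring_Fpxy y"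
  have F: "csubring F"
    unfolding csubring_def
  proof (intro conjI ballI)
    show "1 \<in> F" unfolding F_def by (rule range_eqI[of _ _ 1]) simp
    fix a b assume "a \<in> F" "b \<in> F"
    then obtain c d where "a = fls_const (to_ac c)" "b = fls_const (to_ac d)" by (auto simp: F_def)
    then have "a - b = (fls_const \<circ> to_ac) (c - d)" "a * b = (fls_const \<circ> to_ac) (c * d)"
      by (simp_all flip: fls_minus_const fls_const_mult_const)
    then show "a - b \<in> F" "a * b \<in> F" unfolding F_def by blast+
  qed
  have F_inv: "inverse c \<in> F" if c: "c \<in> F" for c
  proof -
    obtain d where "c = fls_const (to_ac d)" using c by (auto simp: F_def)
    then have "inverse c = (fls_const \<circ> to_ac) (inverse d)" by (simp add: fls_inverse_const)
    then show ?thesis unfolding F_def by blast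
  qed
  have B: "B = ring_gen (F \<union> set us)"
    by (simp add: B_def ring_Fpxy_def L.generate_ring_eq_ring_gen F_def us_def insert_commute)
  have csubB: "csubring B" unfolding B by (rule csubring_ring_gen)
  have indep: "indep F us"
  proof -
    have kt: "subfield field_kt (laurent :: ('p mod_ring, 'p mod_ring alg_closure fls) module)"
      unfolding field_kt_def by (rule L.generate_field_is_subfield) (simp add: L.carrier_R)
    then have csub: "csubring (field_kt :: 'p mod_ring alg_closure fls set)"
      using subfieldE(1) L.subring_iff_csubring by blast
    \<comment> \<open>\<open>y\<close> is given as transcendental over k(x), with \<open>k\<close>
      the algebraic closure, and hence is so over the smaller ring \<open>F[x]\<close>.\<close>
    have "ring_gen (F \<union> {fls_X}) \<subseteq> field_kt"
      by (intro ring_gen_minimal[OF csub]) (auto simp: F_def field_kt_def intro: generate_field.incl)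
    moreover have "transc field_kt (fps_to_fls y)"
      using transcendental L.algebraic_iff_not_transc[OF csub] by blast
    ultimately have "transc (ring_gen (F \<union> {fls_X})) (fps_to_fls y)" by (rule transc_antimono)
    moreover have "transc F (fls_X :: 'p mod_ring alg_closure fls)"
      by (rule transc_fls_X) (auto simp: F_def)
    ultimately show ?thesis by (simp add: us_def ring_gen_id[OF F])
  qed
  \<comment> \<open>Stated for any finitely generated algebra containing \<open>x\<close> and
    \<open>y\<close>, so that it applies to the later images \<open>A l\<close> and to
    \<open>B\<close> itself. The constant 2 is the length of \<open>us\<close>.\<close>
  have dim_add: "krull_dim (sub_laurent C) = 2 + trdeg laurent (fraction_field B) (fraction_field C)"
    and dim_ge: "krull_dim (sub_laurent C) \<ge> 2"
    if C: "C = ring_gen (F \<union> G)" "finite G" "set us \<subseteq> C" for C G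
  proof -
    have csub: "csubring C" unfolding C(1) by (rule csubring_ring_gen)
    have "krull_dim (sub_laurent C) = Sup (rank_set F C)"
      using L.krull_dim_eq_Sup_rank_set[OF F F_inv C(1,2)] .
    also have "\<dots> = enat (length us) + Sup (rank_set (frac B) (frac C))"
      unfolding B by (rule Sup_rank_set_add[OF F csub indep C(3)])
    also have "\<dots> = 2 + trdeg laurent (fraction_field B) (fraction_field C)"
      using L.trdeg_eq_Sup_rank_set[OF csubring_frac[OF csubB], of "frac C"]
      by (simp add: us_def L.generate_field_eq_frac csubB csub numeral_eq_enat)
    finally show *: "krull_dim (sub_laurent C) = 2 + trdeg laurent (fraction_field B) (fraction_field C)" .
    show "krull_dim (sub_laurent C) \<ge> 2" unfolding * by simp
  qed
  \<comment> \<open>For \<open>B\<close> the relative transcendence degree is 0, which identifies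
    the 2 in \<open>dim_add\<close> with the dimension of \<open>B\<close>.\<close>
  have "krull_dim (sub_laurent B) = 2 + trdeg laurent (fraction_field B) (fraction_field B)"
    using ring_gen_incl[of "F \<union> set us"] by (intro dim_add[OF B]) (auto simp: B)
  also have "trdeg laurent (fraction_field B) (fraction_field B) = 0"
    using L.trdeg_eq_Sup_rank_set Sup_rank_set_self csubring_frac[OF csubB]
    by (simp add: L.generate_field_eq_frac[OF csubB])
  finally have dimB: "krull_dim (sub_laurent B) = 2" by simp

  have filt: "filtered_category J" and diag: "algebra_diagram J prime_field S T"
    and cocone: "algebra_cocone J prime_field S T (sub_laurent (valuation_ring y)) \<phi>"
    using colimit by (auto simp: is_filtered_colimit_def)
  interpret filtered_category J by (rule filt)
  interpret D: algebra_diagram J prime_field S T by (rule diag)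
  have \<phi>: "\<phi> j \<in> algebra_hom prime_field (S j) (sub_laurent (valuation_ring y))" if "j \<in> Ob J" for j
    using cocone that by (auto simp: algebra_cocone_def)
  have \<phi>_hom: "\<phi> j \<in> Ring.ring_hom (S j) laurent" if "j \<in> Ob J" for j
    using \<phi>[OF that] by (auto simp: algebra_hom_def Ring.ring_hom_def L.carrier_R)
  have A_mono: "A i \<subseteq> A j" if ij: "i \<in> Ob J" "j \<in> Ob J" "Hom J i j \<noteq> {}" for i j
  proof -
    obtain h where h: "h \<in> Hom J i j" using ij by blast
    have "\<phi> i a = \<phi> j (T i j h a)" "T i j h a \<in> carrier (S j)" if "a \<in> carrier (S i)" for a
      using cocone D.T_hom[OF ij(1,2) h] ij h that
      by (auto simp: algebra_cocone_def algebra_hom_def Ring.ring_hom_def)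
    then show ?thesis unfolding A_def by blast
  qed
  \<comment> \<open>Scalar multiples of 1 in \<open>S j\<close> map precisely onto the prime field
    \<open>F\<close>, so finite type over it passes to the image.\<close>
  have A_gen: "\<exists>G. finite G \<and> A j = ring_gen (F \<union> G)" if j: "j \<in> Ob J" for j
  proof -
    interpret alg: Module.algebra prime_field "S j" by (rule D.algebra[OF j])
    have ring: "ring (S j)" using D.algebra[OF j] by (simp add: Module.algebra_def cring_def)
    have one: "\<one>\<^bsub>S j\<^esub> \<in> carrier (S j)" using ring by (rule ring.ring_simprules(6))
    obtain G where G: "finite G" "G \<subseteq> carrier (S j)" and
      gen: "carrier (S j) = generate_ring (S j)
        ((\<lambda>c. c \<odot>\<^bsub>S j\<^esub> \<one>\<^bsub>S j\<^esub>) ` carrier prime_field \<union> G)" (is "_ = generate_ring _ (?E \<union> G)")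
      using smooth[OF j] by (auto simp: smooth_algebra_def finite_type_algebra_def)
    have carr: "carrier prime_field = (UNIV :: 'p mod_ring set)" by (simp add: ring_of_type_algebra_def)
    have "\<phi> j (c \<odot>\<^bsub>S j\<^esub> \<one>\<^bsub>S j\<^esub>) = fls_const (to_ac c)" for c
    proof -
      have "\<phi> j (c \<odot>\<^bsub>S j\<^esub> \<one>\<^bsub>S j\<^esub>) = c \<odot>\<^bsub>laurent\<^esub> \<phi> j \<one>\<^bsub>S j\<^esub>" "\<phi> j \<one>\<^bsub>S j\<^esub> = 1"
        using \<phi>[OF j] carr one by (auto simp: algebra_hom_def Ring.ring_hom_def L.one_R)
      then show ?thesis by (simp add: laurent_def)
    qed
    then have E: "\<phi> j ` ?E = F" by (simp add: carr F_def image_image comp_def)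
    have "A j = ring_gen (\<phi> j ` (?E \<union> G))"
      unfolding A_def
      by (subst gen, rule L.image_generate_ring[OF ring \<phi>_hom[OF j]]) (use G alg.smult_closed one in auto)
    then show ?thesis using G(1) E by (metis finite_imageI image_Un)
  qed
  have "fls_X \<in> range (fps_to_fls :: 'p mod_ring alg_closure fps \<Rightarrow> _)"
    by (rule range_eqI[of _ _ fps_X]) simp
  then have "fls_X \<in> valuation_ring y" "fps_to_fls y \<in> valuation_ring y"
    unfolding valuation_ring_def field_kxy_def by (blast intro: generate_field.incl)+
  then obtain i a j b where i: "i \<in> Ob J" "a \<in> carrier (S i)" "fls_X = \<phi> i a"
    and j: "j \<in> Ob J" "b \<in> carrier (S j)" "fps_to_fls y = \<phi> j b"
    using filtered_colimit_surj[OF colimit] by (simp add: laurent_def) metis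
  obtain j\<^sub>0 where j0: "j\<^sub>0 \<in> Ob J" "Hom J i j\<^sub>0 \<noteq> {}" "Hom J j j\<^sub>0 \<noteq> {}"
    using bound[OF i(1) j(1)] by blast
  have "fls_X \<in> A i" "fps_to_fls y \<in> A j" using i j by (auto simp: A_def)
  then have usA: "set us \<subseteq> A j\<^sub>0"
    using A_mono[OF i(1) j0(1,2)] A_mono[OF j(1) j0(1,3)] by (auto simp: us_def)
  show ?thesis
  proof (intro bexI[OF _ j0(1)] ballI impI)
    fix l assume l: "l \<in> Ob J" "Hom J j\<^sub>0 l \<noteq> {}"
    have us: "set us \<subseteq> A l" using usA A_mono[OF j0(1) l] by blast
    obtain G where G: "finite G" "A l = ring_gen (F \<union> G)" using A_gen[OF l(1)] by blast
    have csub: "csubring (A l)" unfolding G(2) by (rule csubring_ring_gen)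
    have "F \<subseteq> A l" using G(2) ring_gen_incl[of "F \<union> G"] by blast
    then have "B \<subseteq> A l" unfolding B using us by (intro ring_gen_minimal[OF csub]) auto
    \<comment> \<open>\<open>S l\<close> maps onto \<open>A l\<close>, so the lower bound for the
      image is also one for \<open>S l\<close>.\<close>
    moreover have "krull_dim (sub_laurent (A l)) \<le> krull_dim (S l)"
    proof (rule krull_dim_surj)
      show "cring (S l)" using D.algebra[OF l(1)] by (simp add: Module.algebra_def)
      show "ring (sub_laurent (A l))" using L.cring_subring[OF csub] by (rule cring.axioms)
      show "\<phi> l \<in> Ring.ring_hom (S l) (sub_laurent (A l))"
        using \<phi>_hom[OF l(1)] by (auto simp: Ring.ring_hom_def A_def)
      show "\<phi> l ` carrier (S l) = carrier (sub_laurent (A l))" by (simp add: A_def)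
    qed
    moreover from this have "krull_dim (S l) \<ge> 2" using dim_ge[OF G(2,1) us] by (rule order_trans[rotated])
    ultimately show "fls_X \<in> A l \<and> fps_to_fls y \<in> A l \<and> ring_Fpxy y \<subseteq> A l \<and>
      krull_dim (sub_laurent (A l)) = krull_dim (sub_laurent (ring_Fpxy y)) +
        trdeg laurent (fraction_field (ring_Fpxy y)) (fraction_field (A l)) \<and>
      krull_dim (sub_laurent (A l)) \<ge> 2 \<and> krull_dim (S l) \<ge> 2"
      using us dim_add[OF G(2,1) us] dim_ge[OF G(2,1) us] dimB
      by (auto simp: B_def us_def)
  qed
qed

end
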